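(* Let $G$ be a finite simple unmixed graph without $3$-cycles and without $5$-cycles. The following are equivalent: (a) $I_c(G)$ is linearly presented; (b) for all distinct minimal vertex covers $C_1,C_2$ of $G$, if the induced subgraph $G'=G[C_1\triangle C_2]$ is unmixed then $G'$ is Cohen–Macaulay.
   Context: $G$ has vertices $t_1,\dots,t_s$, $S=K[t_1,\dots,t_s]$, $K$ a field. A graph is unmixed if all minimal vertex covers (inclusion-minimal vertex sets meeting every edge) have equal size. $I_c(G)$ is generated by $\prod_{t_i\in C}t_i$ over minimal vertex covers $C$; a monomial ideal minimally generated by $u_1,\dots,u_r$ is linearly presented if all $u_i$ have the same degree and the kernel of $S^r\to S$, $e_i\mapsto u_i$, is generated by vectors with linear-form entries. $\triangle$ is symmetric difference, $G[L]$ the subgraph induced on $L$. A graph $H$ is Cohen–Macaulay if $R/I(H)$ is Cohen–Macaulay, with $R$ the polynomial ring on $V(H)$ and $I(H)$ generated by $tt'$ for edges $\{t,t'\}$ of $H$. *)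

theory Defs
  imports "HOL-Library.Poly_Mapping" "HOL-Library.Extended_Nat"
begin

definition simple_graph :: "'v set \<Rightarrow> 'v set set \<Rightarrow> bool" where
  "simple_graph V E \<longleftrightarrow> finite V \<and> (\<forall>e\<in>E. e \<subseteq> V \<and> card e = 2)"

definition adj :: "'v set set \<Rightarrow> 'v \<Rightarrow> 'v \<Rightarrow> bool" where
  "adj E a b \<longleftrightarrow> {a, b} \<in> E"

definition is_vertex_cover :: "'v set \<Rightarrow> 'v set set \<Rightarrow> 'v set \<Rightarrow> bool" where
  "is_vertex_cover V E C \<longleftrightarrow> C \<subseteq> V \<and> (\<forall>e\<in>E. e \<inter> C \<noteq> {})"

definition min_vertex_cover :: "'v set \<Rightarrow> 'v set set \<Rightarrow> 'v set \<Rightarrow> bool" where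
  "min_vertex_cover V E C \<longleftrightarrow> is_vertex_cover V E C \<and>
     (\<forall>D. D \<subset> C \<longrightarrow> \<not> is_vertex_cover V E D)"

definition unmixed :: "'v set \<Rightarrow> 'v set set \<Rightarrow> bool" where
  "unmixed V E \<longleftrightarrow> (\<forall>C D. min_vertex_cover V E C \<and> min_vertex_cover V E D \<longrightarrow> card C = card D)"

definition no_3_cycle :: "'v set set \<Rightarrow> bool" where
  "no_3_cycle E \<longleftrightarrow> \<not> (\<exists>a b c. distinct [a, b, c] \<and> adj E a b \<and> adj E b c \<and> adj E c a)"

definition no_5_cycle :: "'v set set \<Rightarrow> bool" where
  "no_5_cycle E \<longleftrightarrow> \<not> (\<exists>a b c d f. distinct [a, b, c, d, f] \<and> adj E a b \<and> adj E b c \<and>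
      adj E c d \<and> adj E d f \<and> adj E f a)"

definition induced_edges :: "'v set set \<Rightarrow> 'v set \<Rightarrow> 'v set set" where
  "induced_edges E L = {e \<in> E. e \<subseteq> L}"

type_synonym ('v, 'k) mpoly = "('v \<Rightarrow>\<^sub>0 nat) \<Rightarrow>\<^sub>0 'k"

definition polys :: "'k::field itself \<Rightarrow> 'v set \<Rightarrow> ('v, 'k) mpoly set" where
  "polys _ V = {p :: ('v, 'k) mpoly. \<forall>m\<in>Poly_Mapping.keys p. Poly_Mapping.keys m \<subseteq> V}"

definition var :: "'v \<Rightarrow> ('v, 'k::field) mpoly" where
  "var v = Poly_Mapping.single (Poly_Mapping.single v 1) 1"

definition mono_deg :: "('v \<Rightarrow>\<^sub>0 nat) \<Rightarrow> nat" where
  "mono_deg m = (\<Sum>v\<in>Poly_Mapping.keys m. Poly_Mapping.lookup m v)"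

definition homogeneous_of_deg :: "nat \<Rightarrow> ('v, 'k::field) mpoly \<Rightarrow> bool" where
  "homogeneous_of_deg d p \<longleftrightarrow> (\<forall>m\<in>Poly_Mapping.keys p. mono_deg m = d)"

text \<open>Linear forms (homogeneous of degree one; zero allowed).\<close>
abbreviation linear_form :: "('v, 'k::field) mpoly \<Rightarrow> bool" where
  "linear_form p \<equiv> homogeneous_of_deg 1 p"

definition is_ideal :: "'k::field itself \<Rightarrow> 'v set \<Rightarrow> ('v, 'k) mpoly set \<Rightarrow> bool" where
  "is_ideal K V I \<longleftrightarrow> I \<subseteq> polys K V \<and> 0 \<in> I \<and> (\<forall>a\<in>I. \<forall>b\<in>I. a + b \<in> I) \<and>
     (\<forall>r\<in>polys K V. \<forall>a\<in>I. r * a \<in> I)"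

definition gen_ideal :: "'k::field itself \<Rightarrow> 'v set \<Rightarrow> ('v, 'k) mpoly set \<Rightarrow> ('v, 'k) mpoly set" where
  "gen_ideal K V A = \<Inter> {I. is_ideal K V I \<and> A \<subseteq> I}"

definition is_prime_ideal :: "'k::field itself \<Rightarrow> 'v set \<Rightarrow> ('v, 'k) mpoly set \<Rightarrow> bool" where
  "is_prime_ideal K V P \<longleftrightarrow> is_ideal K V P \<and> 1 \<notin> P \<and>
     (\<forall>a\<in>polys K V. \<forall>b\<in>polys K V. a * b \<in> P \<longrightarrow> a \<in> P \<or> b \<in> P)"

definition krull_dim_quot :: "'k::field itself \<Rightarrow> 'v set \<Rightarrow> ('v, 'k) mpoly set \<Rightarrow> enat" where
  "krull_dim_quot K V I = Sup {enat n | n. \<exists>P :: nat \<Rightarrow> ('v, 'k) mpoly set.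
      (\<forall>i\<le>n. is_prime_ideal K V (P i) \<and> I \<subseteq> P i) \<and> (\<forall>i<n. P i \<subset> P (Suc i))}"

definition max_hom_ideal :: "'k::field itself \<Rightarrow> 'v set \<Rightarrow> ('v, 'k) mpoly set" where
  "max_hom_ideal K V = gen_ideal K V (var ` V)"

definition regular_seq :: "'k::field itself \<Rightarrow> 'v set \<Rightarrow> ('v, 'k) mpoly set \<Rightarrow> ('v, 'k) mpoly list \<Rightarrow> bool" where
  "regular_seq K V I fs \<longleftrightarrow> set fs \<subseteq> max_hom_ideal K V \<and>
     (\<forall>i<length fs. \<forall>g\<in>polys K V.
        fs ! i * g \<in> gen_ideal K V (I \<union> set (take i fs)) \<longrightarrow> g \<in> gen_ideal K V (I \<union> set (take i fs))) \<and>
     1 \<notin> gen_ideal K V (I \<union> set fs)"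

definition depth_quot :: "'k::field itself \<Rightarrow> 'v set \<Rightarrow> ('v, 'k) mpoly set \<Rightarrow> enat" where
  "depth_quot K V I = Sup {enat (length fs) | fs. regular_seq K V I fs}"

text \<open>K[V]/I (I homogeneous) is Cohen-Macaulay: depth (w.r.t. the maximal homogeneous ideal)
  equals Krull dimension.\<close>
definition cohen_macaulay_quot :: "'k::field itself \<Rightarrow> 'v set \<Rightarrow> ('v, 'k) mpoly set \<Rightarrow> bool" where
  "cohen_macaulay_quot K V I \<longleftrightarrow> depth_quot K V I = krull_dim_quot K V I"

definition edge_ideal :: "'k::field itself \<Rightarrow> 'v set \<Rightarrow> 'v set set \<Rightarrow> ('v, 'k) mpoly set" where
  "edge_ideal K V E = gen_ideal K V {var a * var b | a b. {a, b} \<in> E}"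

definition cohen_macaulay_graph :: "'k::field itself \<Rightarrow> 'v set \<Rightarrow> 'v set set \<Rightarrow> bool" where
  "cohen_macaulay_graph K V E \<longleftrightarrow> cohen_macaulay_quot K V (edge_ideal K V E)"

definition cover_monomial :: "'v set \<Rightarrow> ('v, 'k::field) mpoly" where
  "cover_monomial C = (\<Prod>t\<in>C. var t)"

text \<open>A monomial ideal with minimal generators u_j (j \<in> J), is linearly presented if all u_j have the same
  degree and the kernel of S^J \<rightarrow> S, e_j \<mapsto> u_j, is generated (as S-module) by vectors with linear-form
  entries. Vectors of S^J are functions J \<rightarrow> S (zero outside J).\<close>
definition syz_kernel :: "'k::field itself \<Rightarrow> 'v set \<Rightarrow> 'j set \<Rightarrow> ('j \<Rightarrow> ('v, 'k) mpoly)
    \<Rightarrow> ('j \<Rightarrow> ('v, 'k) mpoly) set" where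
  "syz_kernel K V J u = {x. (\<forall>j\<in>J. x j \<in> polys K V) \<and> (\<forall>j. j \<notin> J \<longrightarrow> x j = 0) \<and>
      (\<Sum>j\<in>J. x j * u j) = 0}"

definition module_span :: "'k::field itself \<Rightarrow> 'v set \<Rightarrow> ('j \<Rightarrow> ('v, 'k) mpoly) set
    \<Rightarrow> ('j \<Rightarrow> ('v, 'k) mpoly) set" where
  "module_span K V B = {(\<lambda>j. \<Sum>i<(n::nat). c i * b i j) | n c b.
      (\<forall>i<n. c i \<in> polys K V \<and> b i \<in> B)}"

definition linearly_presented :: "'k::field itself \<Rightarrow> 'v set \<Rightarrow> 'j set \<Rightarrow> ('j \<Rightarrow> ('v, 'k) mpoly) \<Rightarrow> bool" where
  "linearly_presented K V J u \<longleftrightarrow>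
     (\<exists>d. \<forall>j\<in>J. homogeneous_of_deg d (u j)) \<and>
     syz_kernel K V J u \<subseteq>
       module_span K V {x \<in> syz_kernel K V J u. \<forall>j\<in>J. linear_form (x j)}"

text \<open>I_c(G) is linearly presented: the generators are the cover monomials of the minimal vertex
  covers (these are precisely the minimal monomial generators).\<close>
definition cover_ideal_linearly_presented :: "'k::field itself \<Rightarrow> 'v set \<Rightarrow> 'v set set \<Rightarrow> bool" where
  "cover_ideal_linearly_presented K V E \<longleftrightarrow>
     linearly_presented K V {C. min_vertex_cover V E C} (\<lambda>C. cover_monomial C :: ('v, 'k) mpoly)"

end

theory Submission
  imports Defs "HOL-Library.FuncSet"
begin

text \<open>
  Both conditions are equivalent to the following one: if \<open>C\<close> and \<open>D\<close> are minimal vertex covers and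
  every vertex of \<open>C - D\<close> is adjacent to every vertex of \<open>D - C\<close>, then \<open>C - D\<close> has at most one element.

  If it fails for \<open>C\<close> and \<open>D\<close>, then, since there are no triangles, no minimal vertex cover inside
  \<open>C \<union> D\<close> arises from \<open>C\<close> by a single exchange, so the syzygy between \<open>C\<close> and \<open>D\<close> is not generated by
  linear ones; moreover the graph induced on the symmetric difference is a complete bipartite graph
  \<open>K\<^sub>m\<^sub>,\<^sub>m\<close> with \<open>m \<ge> 2\<close>, which is unmixed of depth 1 and dimension at least 2.

  If it holds, a nonadjacent pair \<open>a \<in> C - D\<close>, \<open>b \<in> D - C\<close> yields a minimal vertex cover inside
  \<open>C \<union> D - {a, b}\<close>, which is closer to both \<open>C\<close> and \<open>D\<close>. Induction on the distance shows that the pair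
  syzygies come from linear ones. When the graph on the symmetric difference is unmixed, the same
  induction produces a perfect matching \<open>\<mu>\<close> for which \<open>a \<sim> \<mu> a'\<close> is antisymmetric in \<open>a\<close> and \<open>a'\<close>;
  unmixedness makes this relation transitive, and then the elements \<open>a - \<mu> a\<close> form a regular sequence
  whose length is the dimension.
\<close>

section \<open>Ideals, primes and regular sequences\<close>

text \<open>Depth and Krull dimension are plain suprema, over regular sequences of arbitrary
  (possibly inhomogeneous) elements and over chains of primes. Every regular sequence yields a chain
  of primes of the same length, so depth never exceeds dimension and regular sequences also give
  lower bounds on dimension. Upper bounds on dimension come from a growth count: a long chain would
  produce more independent products than there are monomials of bounded exponents.

  The condition on pairs of covers must descend from \<open>G\<close> to the graph on the symmetric
  difference. Unmixedness of that graph makes this possible: its minimal covers then have the size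
  of \<open>C - D\<close>, and adding \<open>C \<inter> D\<close> turns them into minimal covers of
  \<open>G\<close>.

  Antisymmetry of the matching survives the induction because an intermediate cover would miss any
  edge from the first half of the matching to partners in the second.

  Linear syzygies force exchanges because all covers have equal size: a cover other than
  \<open>C\<close> inside \<open>insert t C\<close> is obtained from \<open>C\<close> by trading one
  vertex for \<open>t\<close>.\<close>

abbreviation "lookup \<equiv> Poly_Mapping.lookup"
abbreviation "keys \<equiv> Poly_Mapping.keys"
abbreviation "single \<equiv> Poly_Mapping.single"

lemma poly_mapping_sum_single: "(\<Sum>k\<in>keys p. single k (lookup p k)) = p"
proof (rule poly_mapping_eqI)
  fix k
  show "lookup (\<Sum>k\<in>keys p. single k (lookup p k)) k = lookup p k"
    by (cases "k \<in> keys p")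
       (auto simp: lookup_sum lookup_single when_def sum.delta in_keys_iff)
qed

lemma poly_mapping_additive_induct [case_names single add]:
  assumes single: "\<And>k c. P (single k c)"
    and add: "\<And>p q. P p \<Longrightarrow> P q \<Longrightarrow> P (p + q)"
  shows "P (p :: 'a \<Rightarrow>\<^sub>0 'b::comm_monoid_add)"
proof -
  have "P (\<Sum>k\<in>A. single k (lookup p k))" if "finite A" for A
    using that
  proof (induction A)
    case empty
    show ?case using single[of undefined 0] by simp
  qed (auto intro: single add)
  from this[of "keys p"] show ?thesis
    by (simp add: poly_mapping_sum_single)
qed

lemma lookup_single_mult_plus:
  fixes p :: "'a::cancel_comm_monoid_add \<Rightarrow>\<^sub>0 'b::semiring_0"
  shows "lookup (single m c * p) (m + k) = c * lookup p k"
  by (induction p rule: poly_mapping_additive_induct)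
     (auto simp: mult_single lookup_single when_def distrib_left lookup_add)

lemma keys_mult_obtain:
  assumes "k \<in> keys (p * q)"
  obtains a b where "k = a + b" "a \<in> keys p" "b \<in> keys q"
  using keys_mult[of p q] assms by blast

lemma lookup_single_mult_eq_0:
  assumes "\<And>l. k \<noteq> m + l"
  shows "lookup (single m c * p) k = 0"
proof (rule ccontr)
  assume "\<not> ?thesis"
  then have "k \<in> keys (single m c * p)"
    by (simp add: in_keys_iff)
  then show False
    by (rule keys_mult_obtain) (use assms in \<open>auto split: if_splits\<close>)
qed

lemma keys_plus_nat: "keys (m + n :: 'v \<Rightarrow>\<^sub>0 nat) = keys m \<union> keys n"
  by (auto simp: in_keys_iff lookup_add)

section \<open>Polynomials in the variables of a set, and their ideals\<close>

lemma polysI: "(\<And>m. m \<in> keys p \<Longrightarrow> keys m \<subseteq> V) \<Longrightarrow> p \<in> polys K V"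
  by (auto simp: polys_def)

lemma polysD: "p \<in> polys K V \<Longrightarrow> m \<in> keys p \<Longrightarrow> keys m \<subseteq> V"
  by (auto simp: polys_def)

lemma polys_0 [simp, intro]: "0 \<in> polys K V"
  by (auto simp: polys_def)

lemma polys_1 [simp, intro]: "1 \<in> polys K V"
  by (auto simp: polys_def)

lemma polys_single: "keys m \<subseteq> V \<Longrightarrow> single m c \<in> polys K V"
  by (auto simp: polys_def)

lemma polys_var [simp]: "var v \<in> polys K V \<longleftrightarrow> v \<in> V"
  by (auto simp: polys_def var_def)

lemma polys_add [intro]: "p \<in> polys K V \<Longrightarrow> q \<in> polys K V \<Longrightarrow> p + q \<in> polys K V"
  using keys_add[of p q] by (force simp: polys_def)

lemma polys_mult [intro]: "p \<in> polys K V \<Longrightarrow> q \<in> polys K V \<Longrightarrow> p * q \<in> polys K V"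
proof (rule polysI)
  fix m assume "m \<in> keys (p * q)" and pq: "p \<in> polys K V" "q \<in> polys K V"
  then obtain a b where "m = a + b" "a \<in> keys p" "b \<in> keys q" by (auto elim: keys_mult_obtain)
  then show "keys m \<subseteq> V" using polysD[OF pq(1)] polysD[OF pq(2)] by (auto simp: keys_plus_nat)
qed

lemma polys_uminus [intro]: "p \<in> polys K V \<Longrightarrow> - p \<in> polys K V"
  by (auto simp: polys_def in_keys_iff)

lemma polys_diff [intro]: "p \<in> polys K V \<Longrightarrow> q \<in> polys K V \<Longrightarrow> p - q \<in> polys K V"
  using polys_add[of p K V "- q"] by auto

lemma polys_power [intro]: "p \<in> polys K V \<Longrightarrow> p ^ n \<in> polys K V"
  by (induction n) auto

lemma polys_prod: "(\<And>i. i \<in> A \<Longrightarrow> f i \<in> polys K V) \<Longrightarrow> prod f A \<in> polys K V"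
  by (induction A rule: infinite_finite_induct) auto

lemma is_idealD:
  assumes "is_ideal K V I"
  shows "I \<subseteq> polys K V" "0 \<in> I" "a \<in> I \<Longrightarrow> b \<in> I \<Longrightarrow> a + b \<in> I"
    "r \<in> polys K V \<Longrightarrow> a \<in> I \<Longrightarrow> r * a \<in> I"
  using assms by (auto simp: is_ideal_def)

lemma is_ideal_uminus:
  assumes "is_ideal K V I" "a \<in> I"
  shows "- a \<in> I"
  using is_idealD(4)[OF assms(1) polys_uminus[OF polys_1] assms(2)] by simp

lemma is_ideal_diff:
  assumes "is_ideal K V I" "a \<in> I" "b \<in> I"
  shows "a - b \<in> I"
  using is_idealD(3)[OF assms(1,2) is_ideal_uminus[OF assms(1,3)]] by simp

lemma is_ideal_sum:
  assumes "is_ideal K V I" "\<And>i. i \<in> A \<Longrightarrow> f i \<in> I"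
  shows "sum f A \<in> I"
  using assms(2)
  by (induction A rule: infinite_finite_induct) (simp_all add: is_idealD(2,3)[OF assms(1)])

lemma is_ideal_polys: "is_ideal K V (polys K V)"
  by (auto simp: is_ideal_def)

lemma is_ideal_gen_ideal: "A \<subseteq> polys K V \<Longrightarrow> is_ideal K V (gen_ideal K V A)"
proof -
  assume "A \<subseteq> polys K V"
  then have "gen_ideal K V A \<subseteq> polys K V"
    using is_ideal_polys[of K V] unfolding gen_ideal_def by blast
  then show ?thesis unfolding is_ideal_def gen_ideal_def by auto
qed

lemma gen_ideal_superset: "A \<subseteq> gen_ideal K V A"
  by (auto simp: gen_ideal_def)

lemma gen_ideal_least: "is_ideal K V I \<Longrightarrow> A \<subseteq> I \<Longrightarrow> gen_ideal K V A \<subseteq> I"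
  by (auto simp: gen_ideal_def)

lemma gen_ideal_of_ideal: "is_ideal K V I \<Longrightarrow> gen_ideal K V I = I"
  by (metis gen_ideal_least gen_ideal_superset subset_refl subset_antisym)

lemma is_ideal_extend:
  assumes I: "is_ideal K V I" and f: "f \<in> polys K V"
  shows "is_ideal K V {i + h * f | i h. i \<in> I \<and> h \<in> polys K V}" (is "is_ideal _ _ ?J")
  unfolding is_ideal_def
proof (intro conjI ballI)
  show "?J \<subseteq> polys K V" using is_idealD(1)[OF I] f by auto
  show "0 \<in> ?J" using is_idealD(2)[OF I] by force
next
  fix a b assume "a \<in> ?J" "b \<in> ?J"
  then obtain i h i' h' where "a = i + h * f" "b = i' + h' * f" "i \<in> I" "i' \<in> I"
    "h \<in> polys K V" "h' \<in> polys K V" by auto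
  then show "a + b \<in> ?J"
    by (intro CollectI exI[of _ "i + i'"] exI[of _ "h + h'"])
       (auto simp: algebra_simps intro: is_idealD(3)[OF I])
next
  fix r a assume "r \<in> polys K V" "a \<in> ?J"
  then obtain i h where "a = i + h * f" "i \<in> I" "h \<in> polys K V" by auto
  moreover from this have "r * a = r * i + (r * h) * f" by (simp add: algebra_simps)
  ultimately show "r * a \<in> ?J" using \<open>r \<in> polys K V\<close> is_idealD(4)[OF I]
    by blast
qed

lemma gen_ideal_insert:
  assumes I: "is_ideal K V I" and f: "f \<in> polys K V"
  shows "gen_ideal K V (insert f I) = {i + h * f | i h. i \<in> I \<and> h \<in> polys K V}" (is "_ = ?J")
proof
  have "i \<in> ?J" if "i \<in> I" for i using that by force
  moreover have "f \<in> ?J" using is_idealD(2)[OF I] by force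
  ultimately show "gen_ideal K V (insert f I) \<subseteq> ?J"
    by (intro gen_ideal_least[OF is_ideal_extend[OF I f]]) blast
  have J: "is_ideal K V (gen_ideal K V (insert f I))"
    using f is_idealD(1)[OF I] by (intro is_ideal_gen_ideal) auto
  show "?J \<subseteq> gen_ideal K V (insert f I)"
    using gen_ideal_superset[of "insert f I" K V] by (auto intro!: is_idealD(3,4)[OF J])
qed

text \<open>Zorn's lemma gives an ideal maximal among those avoiding a multiplicative set; it is prime.\<close>

lemma prime_ideal_avoiding:
  assumes J: "is_ideal K V J" and M1: "1 \<in> M"
    and Mm: "\<And>a b. a \<in> M \<Longrightarrow> b \<in> M \<Longrightarrow> a * b \<in> M" and JM: "J \<inter> M = {}"
  obtains Q where "is_prime_ideal K V Q" "J \<subseteq> Q" "Q \<inter> M = {}"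
proof -
  define A where "A = {I. is_ideal K V I \<and> J \<subseteq> I \<and> I \<inter> M = {}}"
  have "\<exists>Q\<in>A. \<forall>X\<in>A. Q \<subseteq> X \<longrightarrow> X = Q"
  proof (rule subset_Zorn_nonempty)
    show "A \<noteq> {}" using J JM by (auto simp: A_def)
  next
    fix C assume C: "C \<noteq> {}" "subset.chain A C"
    have CA: "C \<subseteq> A" and lin: "\<And>X Y. X \<in> C \<Longrightarrow> Y \<in> C \<Longrightarrow> X \<subseteq> Y \<or> Y \<subseteq> X"
      using C(2) by (auto simp: subset_chain_def)
    have id: "is_ideal K V X" if "X \<in> C" for X using CA that by (auto simp: A_def)
    have "is_ideal K V (\<Union>C)"
      unfolding is_ideal_def
    proof (intro conjI ballI)
      show "\<Union>C \<subseteq> polys K V" using is_idealD(1)[OF id] by blast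
      show "0 \<in> \<Union>C" using C(1) is_idealD(2)[OF id] by blast
    next
      fix a b assume "a \<in> \<Union>C" "b \<in> \<Union>C"
      then obtain X Y where "a \<in> X" "X \<in> C" "b \<in> Y" "Y \<in> C" by blast
      then show "a + b \<in> \<Union>C" using lin[of X Y] is_idealD(3)[OF id] by blast
    next
      fix r a assume "r \<in> polys K V" "a \<in> \<Union>C"
      then show "r * a \<in> \<Union>C" using is_idealD(4)[OF id] by blast
    qed
    then show "\<Union>C \<in> A" using CA C(1) by (auto simp: A_def)
  qed
  then obtain Q where QA: "Q \<in> A" and max: "\<And>X. X \<in> A \<Longrightarrow> Q \<subseteq> X \<Longrightarrow> X = Q" by blast
  have Q: "is_ideal K V Q" "J \<subseteq> Q" "Q \<inter> M = {}" using QA by (auto simp: A_def)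
  \<comment> \<open>By maximality of \<open>Q\<close>, adjoining \<open>a\<close> must give an ideal
    that meets \<open>M\<close>.\<close>
  have meets: "\<exists>q h. q \<in> Q \<and> h \<in> polys K V \<and> q + h * a \<in> M"
    if a: "a \<in> polys K V" "a \<notin> Q" for a
  proof (rule ccontr)
    assume no: "\<not> ?thesis"
    define X where "X = {i + h * a | i h. i \<in> Q \<and> h \<in> polys K V}"
    have "Q \<subseteq> X" unfolding X_def by force
    moreover have "a \<in> X" unfolding X_def using is_idealD(2)[OF Q(1)] by force
    moreover have "X \<in> A"
      using is_ideal_extend[OF Q(1) a(1)] no \<open>Q \<subseteq> X\<close> Q(2) by (auto simp: A_def X_def)
    ultimately show False using max[of X] a(2) by blast
  qed
  have "is_prime_ideal K V Q"
    unfolding is_prime_ideal_def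
  proof (intro conjI ballI impI)
    show "is_ideal K V Q" "1 \<notin> Q" using Q M1 by auto
    fix a b assume ab: "a \<in> polys K V" "b \<in> polys K V" "a * b \<in> Q"
    show "a \<in> Q \<or> b \<in> Q"
    proof (rule ccontr)
      assume "\<not> ?thesis"
      then obtain q h q' h' where *: "q \<in> Q" "h \<in> polys K V" "q + h * a \<in> M"
        "q' \<in> Q" "h' \<in> polys K V" "q' + h' * b \<in> M"
        using meets[of a] meets[of b] ab by metis
      have "(q + h * a) * (q' + h' * b) = (q' + h' * b) * q + (h * a) * q' + (h * h') * (a * b)"
        by (simp add: algebra_simps)
      also have "\<dots> \<in> Q"
        using * ab is_idealD(1)[OF Q(1)]
        by (intro is_idealD(3)[OF Q(1)]; intro is_idealD(4)[OF Q(1), of "_ + _"]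
            is_idealD(4)[OF Q(1), of "_ * _"]) auto
      finally show False using Mm[OF *(3,6)] Q(3) by blast
    qed
  qed
  then show thesis using that Q by blast
qed

lemma is_prime_idealD:
  assumes "is_prime_ideal K V P"
  shows "is_ideal K V P" "1 \<notin> P"
    "a \<in> polys K V \<Longrightarrow> b \<in> polys K V \<Longrightarrow> a * b \<in> P \<Longrightarrow> a \<in> P \<or> b \<in> P"
  using assms by (auto simp: is_prime_ideal_def)

lemma is_prime_ideal_power:
  assumes "is_prime_ideal K V P" "a \<in> polys K V" "a ^ n \<in> P"
  shows "a \<in> P"
  using assms(3) by (induction n) (use is_prime_idealD[OF assms(1)] assms(2) in auto)

text \<open>An element \<open>f\<close> that is regular modulo \<open>J\<close> is avoided by some prime between \<open>J\<close> and \<open>P\<close>: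
  take the multiplicative set of all \<open>s * f ^ n\<close> with \<open>s \<notin> P\<close>.\<close>

lemma regular_element_smaller_prime:
  assumes P: "is_prime_ideal K V P" and J: "is_ideal K V J" "J \<subseteq> P" and f: "f \<in> P"
    and reg: "\<And>g. g \<in> polys K V \<Longrightarrow> f * g \<in> J \<Longrightarrow> g \<in> J"
  obtains Q where "is_prime_ideal K V Q" "J \<subseteq> Q" "Q \<subset> P"
proof -
  define M where "M = {s * f ^ n | s n. s \<in> polys K V \<and> s \<notin> P}"
  have reg': "g \<in> J" if "g \<in> polys K V" "g * f ^ n \<in> J" for g n
    using that
  proof (induction n)
    case (Suc n)
    have "f \<in> polys K V" using f is_idealD(1)[OF is_prime_idealD(1)[OF P]] by blast
    then have "g * f ^ n \<in> polys K V" using Suc.prems by blast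
    moreover have "f * (g * f ^ n) \<in> J" using Suc.prems by (simp add: mult.left_commute)
    ultimately have "g * f ^ n \<in> J" by (rule reg)
    then show ?case using Suc by blast
  qed simp
  have 1: "1 \<in> M" unfolding M_def using is_prime_idealD(2)[OF P]
    by (intro CollectI exI[of _ 1] exI[of _ 0]) auto
  have 2: "a * b \<in> M" if ab: "a \<in> M" "b \<in> M" for a b
  proof -
    obtain s n t k where *: "a = s * f ^ n" "b = t * f ^ k" "s \<in> polys K V" "s \<notin> P"
      "t \<in> polys K V" "t \<notin> P" using ab unfolding M_def by blast
    have "s * t \<notin> P" using is_prime_idealD(3)[OF P] * by blast
    then show ?thesis unfolding M_def using *
      by (intro CollectI exI[of _ "s * t"] exI[of _ "n + k"]) (auto simp: power_add mult_ac)
  qed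
  have 3: "J \<inter> M = {}" using reg' J(2) unfolding M_def by blast
  from J(1) 1 2 3 obtain Q where Q: "is_prime_ideal K V Q" "J \<subseteq> Q" "Q \<inter> M = {}"
    by (rule prime_ideal_avoiding)
  have "s \<in> M" if "s \<in> polys K V" "s \<notin> P" for s
    unfolding M_def using that by (intro CollectI exI[of _ s] exI[of _ 0]) auto
  then have "Q \<subseteq> P" using Q(3) is_idealD(1)[OF is_prime_idealD(1)[OF Q(1)]] by blast
  moreover have "f \<in> M" unfolding M_def using is_prime_idealD(2)[OF P]
    by (intro CollectI exI[of _ 1] exI[of _ 1]) auto
  ultimately show thesis using that[OF Q(1,2)] Q(3) f by blast
qed

lemma max_hom_ideal_subset_polys: "max_hom_ideal K V \<subseteq> polys K V"
  unfolding max_hom_ideal_def by (rule gen_ideal_least[OF is_ideal_polys]) auto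

text \<open>The chain is built from the top down. It starts at a prime above \<open>I\<close> and
  all of \<open>fs\<close>. Since \<open>fs ! k\<close> lies in the current prime but is regular
  modulo \<open>I\<close> and its predecessors, there is a strictly smaller prime still above
  \<open>I\<close> and the first \<open>k\<close> elements.\<close>

lemma regular_seq_prime_chain:
  assumes fs: "regular_seq K V I fs" and I: "I \<subseteq> polys K V"
  shows "\<exists>P. (\<forall>i\<le>length fs. is_prime_ideal K V (P i) \<and> I \<subseteq> P i) \<and> (\<forall>i<length fs. P i \<subset> P (Suc i))"
proof -
  have fsV: "set fs \<subseteq> polys K V"
    using fs max_hom_ideal_subset_polys by (auto simp: regular_seq_def)
  have chain: "\<exists>P. (\<forall>i\<le>k. is_prime_ideal K V (P i) \<and> I \<subseteq> P i) \<and> (\<forall>i<k. P i \<subset> P (Suc i)) \<and> P k = Q"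
    if "k \<le> length fs" "is_prime_ideal K V Q" "I \<union> set (take k fs) \<subseteq> Q" for k Q
    using that
  proof (induction k arbitrary: Q)
    case 0
    then show ?case by (intro exI[of _ "\<lambda>_. Q"]) auto
  next
    case (Suc k)
    define J where "J = gen_ideal K V (I \<union> set (take k fs))"
    have JV: "I \<union> set (take k fs) \<subseteq> polys K V" using I fsV set_take_subset[of k fs] by blast
    have sub: "set (take k fs) \<subseteq> set (take (Suc k) fs)"
      using set_take_subset_set_take[of k "Suc k" fs] by simp
    have fk: "fs ! k \<in> set (take (Suc k) fs)"
      using Suc.prems(1) by (simp add: take_Suc_conv_app_nth)
    have 1: "is_ideal K V J" unfolding J_def by (rule is_ideal_gen_ideal[OF JV])
    have 2: "J \<subseteq> Q" unfolding J_def
      by (rule gen_ideal_least[OF is_prime_idealD(1)[OF Suc.prems(2)]]) (use Suc.prems(3) sub in blast)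
    have 3: "fs ! k \<in> Q" using Suc.prems(3) fk by blast
    have 4: "g \<in> J" if "g \<in> polys K V" "fs ! k * g \<in> J" for g
      using fs Suc.prems(1) that unfolding regular_seq_def J_def by auto
    from Suc.prems(2) 1 2 3 4 obtain Q' where
      Q': "is_prime_ideal K V Q'" "J \<subseteq> Q'" "Q' \<subset> Q"
      by (rule regular_element_smaller_prime)
    have "I \<union> set (take k fs) \<subseteq> Q'"
      using Q'(2) gen_ideal_superset unfolding J_def by blast
    then obtain P where P: "\<forall>i\<le>k. is_prime_ideal K V (P i) \<and> I \<subseteq> P i" "\<forall>i<k. P i \<subset> P (Suc i)"
      "P k = Q'"
      using Suc.IH[of Q'] Suc.prems(1) Q'(1) by auto
    show ?case
      using P Suc.prems Q'(3)
      by (intro exI[of _ "\<lambda>i. if i \<le> k then P i else Q"]) (auto simp: le_Suc_eq less_Suc_eq)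
  qed
  define J where "J = gen_ideal K V (I \<union> set fs)"
  have J: "is_ideal K V J" unfolding J_def using I fsV by (intro is_ideal_gen_ideal) auto
  have "J \<inter> {1} = {}" using fs unfolding regular_seq_def J_def by auto
  with J obtain Q where Q: "is_prime_ideal K V Q" "J \<subseteq> Q"
    by (elim prime_ideal_avoiding[where M = "{1}"]) auto
  moreover have "I \<union> set (take (length fs) fs) \<subseteq> Q"
    using Q(2) gen_ideal_superset[of "I \<union> set fs" K V] unfolding J_def by auto
  ultimately show ?thesis using chain[of "length fs" Q] by blast
qed

lemma depth_quot_le_krull_dim_quot:
  assumes "I \<subseteq> polys K V"
  shows "depth_quot K V I \<le> krull_dim_quot K V I"
  unfolding depth_quot_def krull_dim_quot_def
proof (rule Sup_subset_mono, rule subsetI)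
  fix n assume "n \<in> {enat (length fs) | fs. regular_seq K V I fs}"
  then obtain fs where "n = enat (length fs)" "regular_seq K V I fs" by auto
  with regular_seq_prime_chain[OF this(2) assms]
  show "n \<in> {enat n | n. \<exists>P. (\<forall>i\<le>n. is_prime_ideal K V (P i) \<and> I \<subseteq> P i) \<and> (\<forall>i<n. P i \<subset> P (Suc i))}"
    by (intro CollectI exI[of _ "length fs"] conjI)
qed

section \<open>Krull dimension\<close>

lemma polys_const [simp, intro]: "single 0 c \<in> polys K V"
  by (auto simp: polys_def)

lemma polys_sum: "(\<And>i. i \<in> A \<Longrightarrow> f i \<in> polys K V) \<Longrightarrow> sum f A \<in> polys K V"
  by (induction A rule: infinite_finite_induct) auto

text \<open>Lexicographic induction: factoring out the lowest power of \<open>x 0\<close> leaves, modulo \<open>x 0 \<in> P 1\<close>,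
  a relation among the remaining elements modulo \<open>P 1\<close>.\<close>

lemma prime_chain_monomials_independent:
  fixes x :: "nat \<Rightarrow> ('v, 'k::field) mpoly"
  assumes "\<And>i. i \<le> m \<Longrightarrow> is_prime_ideal K V (P i)" "\<And>i. i < m \<Longrightarrow> P i \<subseteq> P (Suc i)"
    and "\<And>i. i < m \<Longrightarrow> x i \<in> P (Suc i) - P i"
    and "(\<Sum>es\<in>{es. set es \<subseteq> {..N} \<and> length es = m}. single 0 (c es) * (\<Prod>i<m. x i ^ (es ! i))) \<in> P 0"
    and "set es \<subseteq> {..N}" "length es = m"
  shows "c es = 0"
  using assms
proof (induction m arbitrary: x P c es)
  case 0
  show ?case
  proof (rule ccontr)
    assume ne: "c es \<noteq> 0"
    have "{es. set es \<subseteq> {..N} \<and> length es = 0} = {es}" using 0 by auto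
    then have "single 0 (c es) \<in> P 0" using "0.prems"(4) by simp
    then have "single 0 (inverse (c es)) * single 0 (c es) \<in> P 0"
      using is_idealD(4)[OF is_prime_idealD(1)[OF "0.prems"(1)]] by blast
    then show False using is_prime_idealD(2)[OF "0.prems"(1)] ne by (auto simp: mult_single)
  qed
next
  case (Suc m)
  \<comment> \<open>Grouping by the first exponent turns the relation into a polynomial in
    \<open>x 0\<close> with coefficients \<open>g p\<close>.\<close>
  define g where "g p = (\<Sum>es\<in>{es. set es \<subseteq> {..N} \<and> length es = m}.
    single 0 (c (p # es)) * (\<Prod>i<m. x (Suc i) ^ (es ! i)))" for p
  have P0: "is_prime_ideal K V (P 0)" and P1: "is_prime_ideal K V (P (Suc 0))"
    using Suc.prems(1) by auto
  note I0 = is_prime_idealD(1)[OF P0] and I1 = is_prime_idealD(1)[OF P1]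
  have xV: "x i \<in> polys K V" if "i < Suc m" for i
    using Suc.prems(3)[OF that] is_idealD(1)[OF is_prime_idealD(1)[OF Suc.prems(1)[of "Suc i"]]] that
    by auto
  have gV: "g p \<in> polys K V" for p
    unfolding g_def by (intro polys_sum polys_mult polys_prod polys_power polys_const xV) auto
  have eq: "(\<Sum>es\<in>{es. set es \<subseteq> {..N} \<and> length es = Suc m}. single 0 (c es) * (\<Prod>i<Suc m. x i ^ (es ! i)))
      = (\<Sum>p\<le>N. x 0 ^ p * g p)"
    unfolding lists_length_Suc_eq g_def sum_distrib_left
    by (subst sum.reindex, force simp: inj_on_def, subst sum.swap, subst sum.cartesian_product)
       (auto simp: mult_ac prod.lessThan_Suc_shift intro!: sum.cong simp del: prod.lessThan_Suc)
  have gz: "\<forall>es. set es \<subseteq> {..N} \<and> length es = m \<longrightarrow> c (p # es) = 0" if "p \<le> N" for p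
    using that
  proof (induction p rule: less_induct)
    case (less p)
    \<comment> \<open>The lower coefficients vanish as polynomials, not only modulo
      \<open>P 0\<close>, because all their scalars are already zero.\<close>
    have "g q = 0" if "q < p" for q
      unfolding g_def using less.IH[OF that] less.prems that by (intro sum.neutral) auto
    then have "(\<Sum>q\<le>N. x 0 ^ q * g q) = (\<Sum>q\<in>{p..N}. x 0 ^ q * g q)"
      by (intro sum.mono_neutral_right) auto
    also have "{p..N} = insert p {Suc p..N}" using less.prems by auto
    also have "(\<Sum>q\<in>insert p {Suc p..N}. x 0 ^ q * g q) = x 0 ^ p * g p + (\<Sum>q\<in>{Suc p..N}. x 0 ^ q * g q)"
      by simp
    also have "(\<Sum>q\<in>{Suc p..N}. x 0 ^ q * g q) = (\<Sum>q\<in>{Suc p..N}. x 0 ^ p * (x 0 * (x 0 ^ (q - Suc p) * g q)))"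
      by (intro sum.cong refl) (auto simp: mult.assoc[symmetric] power_add[symmetric] power_Suc[symmetric] simp del: power_Suc)
    also have "\<dots> = x 0 ^ p * (x 0 * (\<Sum>q\<in>{Suc p..N}. x 0 ^ (q - Suc p) * g q))"
      by (simp add: sum_distrib_left)
    finally have *: "(\<Sum>q\<le>N. x 0 ^ q * g q) = x 0 ^ p * (g p + x 0 * (\<Sum>q\<in>{Suc p..N}. x 0 ^ (q - Suc p) * g q))"
      (is "_ = _ * (_ + _ * ?h)") by (simp add: distrib_left)
    have hV: "?h \<in> polys K V" by (intro polys_sum polys_mult polys_power gV xV) auto
    have "x 0 ^ p * (g p + x 0 * ?h) \<in> P 0"
      using Suc.prems(4) unfolding eq * .
    then have "x 0 ^ p \<in> P 0 \<or> g p + x 0 * ?h \<in> P 0"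
      using xV hV gV by (intro is_prime_idealD(3)[OF P0]) auto
    then have "g p + x 0 * ?h \<in> P (Suc 0)"
      using is_prime_ideal_power[OF P0 xV] Suc.prems(2,3)[of 0] by auto
    moreover have "x 0 * ?h \<in> P (Suc 0)"
      using is_idealD(4)[OF I1 hV, of "x 0"] Suc.prems(3)[of 0] by (simp add: mult.commute)
    ultimately have "g p \<in> P (Suc 0)" using is_ideal_diff[OF I1] by fastforce
    then show ?case
      using Suc.IH[of "\<lambda>i. P (Suc i)" "\<lambda>i. x (Suc i)" "\<lambda>es. c (p # es)"] Suc.prems(1-3)
      unfolding g_def by auto
  qed
  obtain p es' where "es = p # es'" using Suc.prems(6) by (cases es) auto
  then show ?case using gz Suc.prems by auto
qed

section \<open>Counting monomials to bound the length of prime chains\<close>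

lemma card_bounded_monomials_le:
  fixes U :: "'v set" and d :: nat
  assumes "finite U"
  defines "B \<equiv> {m. keys m \<subseteq> U \<and> (\<forall>v. lookup m v \<le> d)}"
  shows "finite B" "card B \<le> (d + 1) ^ card U"
proof -
  have fin: "finite (U \<rightarrow>\<^sub>E {..d})" using assms by (intro finite_PiE) auto
  have inj: "inj_on (\<lambda>m. restrict (lookup m) U) B"
  proof (rule inj_onI)
    fix m n assume mn: "m \<in> B" "n \<in> B" "restrict (lookup m) U = restrict (lookup n) U"
    show "m = n"
    proof (rule poly_mapping_eqI)
      fix v
      show "lookup m v = lookup n v"
      proof (cases "v \<in> U")
        case True
        then show ?thesis using fun_cong[OF mn(3), of v] by simp
      next
        case False
        then have "v \<notin> keys m" "v \<notin> keys n" using mn by (auto simp: B_def)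
        then show ?thesis by (simp add: in_keys_iff)
      qed
    qed
  qed
  have im: "(\<lambda>m. restrict (lookup m) U) ` B \<subseteq> (U \<rightarrow>\<^sub>E {..d})"
    by (auto simp: B_def)
  show "finite B" using inj_on_finite[OF inj im fin] .
  have "card B \<le> card (U \<rightarrow>\<^sub>E {..d})" using card_inj_on_le[OF inj im fin] .
  then show "card B \<le> (d + 1) ^ card U" using assms by (simp add: card_PiE)
qed

lemma vector_space_mpoly: "vector_space (\<lambda>(c::'k::field) (p :: ('v, 'k) mpoly). single 0 c * p)"
  by unfold_locales (auto simp: algebra_simps single_add mult_single mult.assoc[symmetric])

text \<open>Each exponent is bounded separately, instead of the total degree, so that the number of
  admissible monomials is at most a plain power.\<close>

definition exps_le :: "nat \<Rightarrow> ('v, 'k::field) mpoly \<Rightarrow> bool" where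
  "exps_le d p \<longleftrightarrow> (\<forall>m\<in>keys p. \<forall>v. lookup m v \<le> d)"

lemma exps_le_mult: "exps_le d p \<Longrightarrow> exps_le e q \<Longrightarrow> exps_le (d + e) (p * q)"
  unfolding exps_le_def by (auto elim!: keys_mult_obtain simp: lookup_add add_mono)

lemma exps_le_power: "exps_le d p \<Longrightarrow> exps_le (n * d) (p ^ n)"
proof (induction n)
  case 0
  then show ?case by (auto simp: exps_le_def)
next
  case (Suc n)
  then show ?case using exps_le_mult[of d p "n * d" "p ^ n"] by simp
qed

lemma exps_le_prod:
  assumes "\<And>i. i \<in> A \<Longrightarrow> exps_le (d i) (f i)"
  shows "exps_le (\<Sum>i\<in>A. d i) (\<Prod>i\<in>A. f i)"
  using assms
proof (induction A rule: infinite_finite_induct)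
  case (insert x F)
  then show ?case by (auto intro!: exps_le_mult)
qed (auto simp: exps_le_def)

lemma exps_le_mono: "exps_le d p \<Longrightarrow> d \<le> e \<Longrightarrow> exps_le e p"
  unfolding exps_le_def using le_trans by blast

lemma exps_le_exists: "\<exists>d. exps_le d p"
proof -
  have "finite (\<Union>m\<in>keys p. lookup m ` keys m)" by auto
  then obtain d where d: "\<forall>n\<in>(\<Union>m\<in>keys p. lookup m ` keys m). n \<le> d"
    by (auto simp: finite_nat_set_iff_bounded_le)
  have "lookup m v \<le> d" if "m \<in> keys p" for m v
    using d that by (cases "v \<in> keys m") (auto simp: in_keys_iff)
  then show ?thesis by (auto simp: exps_le_def)
qed

lemma single_factor_var:
  assumes "v \<in> keys k"
  shows "single k c = single (k - single v 1) c * var v"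
proof -
  have "k - single v 1 + single v 1 = k"
    using assms by (intro poly_mapping_eqI) (auto simp: lookup_add lookup_minus lookup_single when_def in_keys_iff)
  then show ?thesis by (simp add: var_def mult_single)
qed

lemma keys_minus_nat: "keys (m - n :: 'v \<Rightarrow>\<^sub>0 nat) \<subseteq> keys m"
  by (auto simp: in_keys_iff lookup_minus)

text \<open>Every term that involves a variable of \<open>C\<close> lies in \<open>I\<close> and can
  be deleted. In a chain of primes this makes the elements separating consecutive primes free of the
  variables that lie in the smallest prime.\<close>

lemma reduce_mod_vars:
  assumes I: "is_ideal K V I" and C: "var ` C \<subseteq> I" and f: "f \<in> polys K V"
  obtains f' where "f' \<in> polys K (V - C)" "f - f' \<in> I"
proof -
  define f' where "f' = (\<Sum>k\<in>{k\<in>keys f. keys k \<inter> C = {}}. single k (lookup f k))"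
  have *: "f = f' + (\<Sum>k\<in>{k\<in>keys f. keys k \<inter> C \<noteq> {}}. single k (lookup f k))"
    unfolding f'_def
    by (subst poly_mapping_sum_single[of f, symmetric], subst sum.union_disjoint[symmetric])
       (auto intro!: sum.cong)
  have "(\<Sum>k\<in>{k\<in>keys f. keys k \<inter> C \<noteq> {}}. single k (lookup f k)) \<in> I"
  proof (rule is_ideal_sum[OF I])
    fix k assume "k \<in> {k\<in>keys f. keys k \<inter> C \<noteq> {}}"
    then obtain v where v: "v \<in> keys k" "v \<in> C" "k \<in> keys f" by auto
    have "single (k - single v 1) (lookup f k) \<in> polys K V"
      using keys_minus_nat[of k "single v 1"] polysD[OF f v(3)] by (intro polys_single) auto
    then have "single (k - single v 1) (lookup f k) * var v \<in> I"
      by (rule is_idealD(4)[OF I]) (use C v(2) in blast)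
    then show "single k (lookup f k) \<in> I"
      by (simp only: single_factor_var[OF v(1), symmetric])
  qed
  moreover have "f' \<in> polys K (V - C)"
    unfolding f'_def using polysD[OF f] by (intro polys_sum polys_single) blast
  moreover have "f - f' = (\<Sum>k\<in>{k\<in>keys f. keys k \<inter> C \<noteq> {}}. single k (lookup f k))"
    using * by (simp add: algebra_simps)
  ultimately show thesis using that[of f'] by simp
qed

text \<open>Choose \<open>x i\<close> in \<open>P (Suc i) - P i\<close>, free of \<open>C\<close>.
  The \<open>(N + 1) ^ m\<close> products with exponents up to \<open>N\<close> are independent, yet
  lie in the span of at most \<open>(m * (N * D) + 1) ^ n\<close> monomials, where
  \<open>n = card (V - C)\<close>. For large \<open>N\<close> this is impossible unless
  \<open>m \<le> n\<close>.\<close>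

lemma prime_chain_length_le:
  fixes P :: "nat \<Rightarrow> ('v, 'k::field) mpoly set"
  assumes P: "\<And>i. i \<le> m \<Longrightarrow> is_prime_ideal K V (P i)" "\<And>i. i < m \<Longrightarrow> P i \<subset> P (Suc i)"
    and C: "var ` C \<subseteq> P 0" and fin: "finite V"
  shows "m \<le> card (V - C)"
proof -
  have I: "is_ideal K V (P i)" if "i \<le> m" for i using is_prime_idealD(1)[OF P(1)[OF that]] .
  have mono: "P 0 \<subseteq> P i" if "i \<le> m" for i using that
    by (induction i) (use P(2) in \<open>auto simp: Suc_le_eq\<close>)
  have "\<exists>x. x \<in> polys K (V - C) \<and> x \<in> P (Suc i) - P i" if i: "i < m" for i
  proof -
    obtain f where f: "f \<in> P (Suc i)" "f \<notin> P i" using P(2)[OF i] by blast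
    have fV: "f \<in> polys K V" using f is_idealD(1)[OF I[of "Suc i"]] i by auto
    obtain f' where f': "f' \<in> polys K (V - C)" "f - f' \<in> P 0"
      by (rule reduce_mod_vars[OF I[of 0] C fV]) auto
    have "f' \<in> P (Suc i)" using is_ideal_diff[OF I[of "Suc i"] f(1), of "f - f'"] f'(2) mono[of "Suc i"] i by auto
    moreover have "f' \<notin> P i"
      using is_idealD(3)[OF I[of i], of "f - f'" f'] f'(2) mono[of i] i f(2) by auto
    ultimately show ?thesis using f'(1) by blast
  qed
  then obtain x where x: "\<And>i. i < m \<Longrightarrow> x i \<in> polys K (V - C) \<and> x i \<in> P (Suc i) - P i" by metis
  have "\<exists>D. \<forall>i<m. exps_le D (x i)"
  proof -
    define d where "d i = (SOME d. exps_le d (x i))" for i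
    have "exps_le (d i) (x i)" for i unfolding d_def by (rule someI_ex[OF exps_le_exists])
    then have "exps_le (Max (d ` {..<m})) (x i)" if "i < m" for i
      by (rule exps_le_mono) (use that in auto)
    then show ?thesis by blast
  qed
  then obtain D where D: "\<And>i. i < m \<Longrightarrow> exps_le D (x i)" by blast
  define n where "n = card (V - C)"
  have count: "(N + 1) ^ m \<le> (m * (N * D) + 1) ^ n" for N
  proof -
    interpret vs: vector_space "\<lambda>(c::'k) (p :: ('v, 'k) mpoly). single 0 c * p"
      by (rule vector_space_mpoly)
    define L where "L = {es. set es \<subseteq> {..N} \<and> length es = m}"
    define X where "X es = (\<Prod>i<m. x i ^ (es ! i))" for es
    define B where "B = {k :: 'v \<Rightarrow>\<^sub>0 nat. keys k \<subseteq> V - C \<and> (\<forall>v. lookup k v \<le> m * (N * D))}"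
    have finL: "finite L" unfolding L_def by (rule finite_lists_length_eq) auto
    have B: "finite B" "card B \<le> (m * (N * D) + 1) ^ n"
      unfolding B_def n_def using card_bounded_monomials_le[of "V - C"] fin by auto
    have ind: "c es = 0" if "(\<Sum>es\<in>L. single 0 (c es) * X es) = 0" "es \<in> L" for c es
      using prime_chain_monomials_independent[of m K V P x c N es] P x that is_idealD(2)[OF I[of 0]]
      unfolding L_def X_def by auto
    \<comment> \<open>Linear independence below concerns the set of products, so coincidences must
      be excluded first; one would be a relation with coefficients 1 and -1.\<close>
    have inj: "inj_on X L"
    proof (rule inj_onI, rule ccontr)
      fix es fs assume ef: "es \<in> L" "fs \<in> L" "X es = X fs" "es \<noteq> fs"
      define c :: "nat list \<Rightarrow> 'k" where "c = (\<lambda>hs. if hs = es then 1 else if hs = fs then -1 else 0)"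
      have "(\<Sum>hs\<in>L. single 0 (c hs) * X hs) = (\<Sum>hs\<in>{es, fs}. single 0 (c hs) * X hs)"
        using ef finL by (intro sum.mono_neutral_right) (auto simp: c_def)
      also have "\<dots> = 0" using ef by (simp add: c_def single_uminus)
      finally show False using ind[of c es] ef by (simp add: c_def)
    qed
    have "vs.independent (X ` L)"
    proof
      assume "vs.dependent (X ` L)"
      then obtain u where u: "\<exists>v\<in>X ` L. u v \<noteq> 0" "(\<Sum>v\<in>X ` L. single 0 (u v) * v) = 0"
        using finL by (subst (asm) vs.dependent_finite) auto
      then show False using ind[of "\<lambda>es. u (X es)"] by (auto simp: sum.reindex[OF inj])
    qed
    moreover have "X ` L \<subseteq> vs.span ((\<lambda>k. single k 1) ` B)"
    proof
      fix p assume "p \<in> X ` L"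
      then obtain es where es: "es \<in> L" "p = X es" by auto
      have "exps_le (\<Sum>i<m. es ! i * D) p"
        unfolding es X_def using D by (intro exps_le_prod exps_le_power) auto
      moreover have "(\<Sum>i<m. es ! i * D) \<le> (\<Sum>i<m. N * D)"
        using es unfolding L_def by (intro sum_mono mult_right_mono) (auto simp: subset_iff)
      ultimately have "exps_le (m * (N * D)) p" by (simp add: exps_le_mono)
      moreover have "p \<in> polys K (V - C)"
        unfolding es X_def using x by (intro polys_prod polys_power) auto
      ultimately have "keys p \<subseteq> B" unfolding B_def exps_le_def by (auto dest!: polysD)
      then have "(\<Sum>k\<in>keys p. single 0 (lookup p k) * single k 1) \<in> vs.span ((\<lambda>k. single k 1) ` B)"
        by (intro vs.span_sum vs.span_scale vs.span_base) auto
      then show "p \<in> vs.span ((\<lambda>k. single k 1) ` B)"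
        by (simp add: mult_single poly_mapping_sum_single)
    qed
    ultimately have "card (X ` L) \<le> card ((\<lambda>k. single k (1::'k)) ` B)"
      using vs.independent_span_bound[of "(\<lambda>k. single k 1) ` B" "X ` L"] B(1) by auto
    also have "\<dots> \<le> card B" by (rule card_image_le[OF B(1)])
    finally have "card L \<le> card B" by (simp add: card_image[OF inj])
    then show ?thesis using B(2) card_lists_length_eq[of "{..N}" m] by (simp add: L_def)
  qed
  show ?thesis
  proof (rule ccontr)
    assume "\<not> ?thesis"
    then have nm: "Suc n \<le> m" by (simp add: n_def)
    \<comment> \<open>With this \<open>N\<close> the bound
      \<open>((m * D + 1) * (N + 1)) ^ n\<close> equals \<open>N * (N + 1) ^ n\<close>, which is
      just below \<open>(N + 1) ^ Suc n\<close>.\<close>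
    define N where "N = (m * D + 1) ^ n"
    have "(N + 1) ^ Suc n \<le> (N + 1) ^ m" using nm by (intro power_increasing) auto
    also have "\<dots> \<le> (m * (N * D) + 1) ^ n" by (rule count)
    also have "\<dots> \<le> ((m * D + 1) * (N + 1)) ^ n" by (intro power_mono) (auto simp: algebra_simps)
    also have "\<dots> = N * (N + 1) ^ n" unfolding N_def by (rule power_mult_distrib)
    finally have "(N + 1) * (N + 1) ^ n \<le> N * (N + 1) ^ n" by simp
    then show False by simp
  qed
qed

section \<open>Minimal vertex covers\<close>

lemma simple_graph_finite: "simple_graph V E \<Longrightarrow> finite V"
  by (simp add: simple_graph_def)

lemma simple_graph_edgeE:
  assumes "simple_graph V E" "e \<in> E"
  obtains x y where "e = {x, y}" "x \<noteq> y" "x \<in> V" "y \<in> V"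
proof -
  have "e \<subseteq> V" "card e = 2" using assms by (auto simp: simple_graph_def)
  then show thesis using that by (auto simp: card_2_iff)
qed

lemma simple_graph_edge_neq: "simple_graph V E \<Longrightarrow> {x, y} \<in> E \<Longrightarrow> x \<noteq> y"
  unfolding simple_graph_def by fastforce

lemma simple_graph_edge_in: "simple_graph V E \<Longrightarrow> {x, y} \<in> E \<Longrightarrow> x \<in> V \<and> y \<in> V"
  unfolding simple_graph_def by blast

lemma vertex_coverI:
  assumes "simple_graph V E" "C \<subseteq> V" "\<And>x y. {x, y} \<in> E \<Longrightarrow> x \<notin> C \<Longrightarrow> y \<in> C"
  shows "is_vertex_cover V E C"
  unfolding is_vertex_cover_def
proof (intro conjI ballI)
  fix e assume "e \<in> E"
  then obtain x y where "e = {x, y}" using simple_graph_edgeE[OF assms(1)] by metis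
  then show "e \<inter> C \<noteq> {}" using assms(3)[of x y] \<open>e \<in> E\<close> by blast
qed (rule assms(2))

lemma vertex_coverD: "is_vertex_cover V E C \<Longrightarrow> {x, y} \<in> E \<Longrightarrow> x \<notin> C \<Longrightarrow> y \<in> C"
  by (auto simp: is_vertex_cover_def)

lemma min_vertex_coverD:
  assumes "min_vertex_cover V E C"
  shows "is_vertex_cover V E C" "C \<subseteq> V" "{x, y} \<in> E \<Longrightarrow> x \<notin> C \<Longrightarrow> y \<in> C"
  using assms by (auto simp: min_vertex_cover_def is_vertex_cover_def)

text \<open>Minimality in local form: an edge left uncovered by \<open>C - {x}\<close> must contain
  \<open>x\<close>, and its other end is outside \<open>C\<close>.\<close>

lemma min_vertex_cover_neighbour:
  assumes G: "simple_graph V E" and C: "min_vertex_cover V E C" and x: "x \<in> C"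
  obtains y where "{x, y} \<in> E" "y \<notin> C"
proof -
  have "\<not> is_vertex_cover V E (C - {x})"
    using C x unfolding min_vertex_cover_def by blast
  then obtain a b where ab: "{a, b} \<in> E" "a \<notin> C - {x}" "b \<notin> C - {x}"
    using vertex_coverI[OF G, of "C - {x}"] min_vertex_coverD(2)[OF C] by blast
  then have "a \<noteq> b" using simple_graph_edge_neq[OF G] by blast
  then show thesis
    using ab min_vertex_coverD(3)[OF C] that[of a] that[of b] by (metis DiffI insert_commute singletonD)
qed

lemma min_vertex_coverI:
  assumes "is_vertex_cover V E C" "\<And>x. x \<in> C \<Longrightarrow> \<exists>y. {x, y} \<in> E \<and> y \<notin> C"
  shows "min_vertex_cover V E C"
  unfolding min_vertex_cover_def
proof (intro conjI allI impI notI)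
  fix D assume D: "D \<subset> C" "is_vertex_cover V E D"
  then obtain x where x: "x \<in> C" "x \<notin> D" by blast
  then obtain y where "{x, y} \<in> E" "y \<notin> C" using assms(2) by blast
  then show False using vertex_coverD[OF D(2)] x D(1) by blast
qed (rule assms(1))

lemma min_vertex_cover_below:
  assumes "is_vertex_cover V E C" "finite V"
  obtains D where "D \<subseteq> C" "min_vertex_cover V E D"
proof -
  have "finite {D. D \<subseteq> C \<and> is_vertex_cover V E D}"
    using assms by (auto simp: is_vertex_cover_def intro: finite_subset[of _ "Pow V"])
  then obtain D where D: "D \<subseteq> C" "is_vertex_cover V E D"
    and min: "\<And>D'. D' \<subseteq> C \<and> is_vertex_cover V E D' \<Longrightarrow> D' \<subseteq> D \<Longrightarrow> D = D'"
    using finite_has_minimal2[of "{D. D \<subseteq> C \<and> is_vertex_cover V E D}" C] assms(1) by auto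
  then have "min_vertex_cover V E D" unfolding min_vertex_cover_def by blast
  then show thesis using that D by blast
qed

lemma unmixed_card_le_cover:
  assumes "simple_graph V E" "unmixed V E" "min_vertex_cover V E C" "is_vertex_cover V E D"
  shows "card C \<le> card D"
proof -
  obtain D' where D': "D' \<subseteq> D" "min_vertex_cover V E D'"
    using min_vertex_cover_below[OF assms(4)] assms(1) simple_graph_finite by blast
  have "card D' \<le> card D"
    using D'(1) assms(1,4) by (intro card_mono) (auto simp: is_vertex_cover_def simple_graph_def intro: finite_subset)
  then show ?thesis using assms(2,3) D'(2) by (metis unmixed_def)
qed

lemma unmixed_cover_card_eq_min:
  assumes "simple_graph V E" "unmixed V E" "min_vertex_cover V E C" "is_vertex_cover V E D"
    and "card D = card C"
  shows "min_vertex_cover V E D"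
  unfolding min_vertex_cover_def
proof (intro conjI allI impI notI)
  fix D' assume D': "D' \<subset> D" "is_vertex_cover V E D'"
  have "finite D" using assms(1,4) by (auto simp: is_vertex_cover_def simple_graph_def intro: finite_subset)
  then have "card D' < card D" using D'(1) by (rule psubset_card_mono)
  then show False using unmixed_card_le_cover[OF assms(1-3) D'(2)] assms(5) by simp
qed (rule assms(4))

lemma unmixed_card_diff:
  assumes "simple_graph V E" "unmixed V E" "min_vertex_cover V E C" "min_vertex_cover V E D"
  shows "card (C - D) = card (D - C)"
proof -
  have fin: "finite C" "finite D"
    using min_vertex_coverD(2)[OF assms(3)] min_vertex_coverD(2)[OF assms(4)] simple_graph_finite[OF assms(1)]
    by (auto intro: finite_subset)
  have "card C = card D" using assms(2-4) unfolding unmixed_def by blast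
  then show ?thesis
    using card_Diff_subset_Int[of C D] card_Diff_subset_Int[of D C] fin by (simp add: Int_commute)
qed

text \<open>A vertex outside \<open>C \<union> D\<close> has all its neighbours in
  \<open>C \<inter> D\<close>, so it needs neither \<open>a\<close> nor \<open>b\<close>. The
  neighbours of \<open>a\<close> lie in \<open>D\<close> and differ from \<open>b\<close>, those of
  \<open>b\<close> lie in \<open>C\<close> and differ from \<open>a\<close>. Hence
  \<open>C \<union> D - {a, b}\<close> still covers.\<close>

lemma min_vertex_cover_avoiding:
  assumes G: "simple_graph V E" and C: "min_vertex_cover V E C" and D: "min_vertex_cover V E D"
    and a: "a \<in> C - D" and b: "b \<in> D - C" and ab: "{a, b} \<notin> E"
  obtains J where "min_vertex_cover V E J" "J \<subseteq> C \<union> D - {a, b}"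
proof -
  have "is_vertex_cover V E (C \<union> D - {a, b})"
  proof (rule vertex_coverI[OF G])
    show "C \<union> D - {a, b} \<subseteq> V" using min_vertex_coverD(2)[OF C] min_vertex_coverD(2)[OF D] by blast
    fix x y assume xy: "{x, y} \<in> E" "x \<notin> C \<union> D - {a, b}"
    then have "y \<noteq> x" "y \<notin> {a, b} \<or> x \<notin> {a, b}"
      using simple_graph_edge_neq[OF G xy(1)] ab by (auto simp: insert_commute)
    then show "y \<in> C \<union> D - {a, b}"
      using min_vertex_coverD(3)[OF C, of x y] min_vertex_coverD(3)[OF D, of x y]
        min_vertex_coverD(3)[OF C, of y x] min_vertex_coverD(3)[OF D, of y x] xy a b
      by (auto simp: insert_commute)
  qed
  then show thesis using min_vertex_cover_below simple_graph_finite[OF G] that by metis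
qed

section \<open>Exchanges between covers and matchings in the bipartite case\<close>

definition complete_between :: "'v set set \<Rightarrow> 'v set \<Rightarrow> 'v set \<Rightarrow> bool" where
  "complete_between E A B \<longleftrightarrow> (\<forall>a\<in>A. \<forall>b\<in>B. {a, b} \<in> E)"

definition thin_complete_pairs :: "'v set \<Rightarrow> 'v set set \<Rightarrow> bool" where
  "thin_complete_pairs V E \<longleftrightarrow> (\<forall>C D. min_vertex_cover V E C \<and> min_vertex_cover V E D \<and>
     complete_between E (C - D) (D - C) \<longrightarrow> card (C - D) \<le> 1)"

lemma thin_complete_pairs_nonadjacent:
  assumes "thin_complete_pairs V E" "min_vertex_cover V E C" "min_vertex_cover V E D" "card (C - D) > 1"
  obtains a b where "a \<in> C - D" "b \<in> D - C" "{a, b} \<notin> E"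
  using assms unfolding thin_complete_pairs_def complete_between_def by (meson leD)

lemma no_exchange_of_complete_between:
  assumes G: "simple_graph V E" and T: "no_3_cycle E"
    and C: "min_vertex_cover V E C" and D: "min_vertex_cover V E D"
    and cb: "complete_between E (C - D) (D - C)" and big: "card (D - C) > 1"
    and t: "t \<in> D - C" and s: "s \<in> C"
  shows "\<not> min_vertex_cover V E (insert t C - {s})"
proof
  assume J: "min_vertex_cover V E (insert t C - {s})"
  show False
  proof (cases "s \<in> D")
    \<comment> \<open>A second vertex \<open>b\<close> of \<open>D - C\<close> is adjacent to
      \<open>s\<close>, and the edge \<open>{s, b}\<close> is uncovered after the exchange.\<close>
    case False
    have "D - C \<noteq> {t}" using big by auto
    then obtain b where b: "b \<in> D - C" "b \<noteq> t" using t by blast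
    then have "{s, b} \<in> E" using cb s False unfolding complete_between_def by blast
    then show False using min_vertex_coverD(3)[OF J, of s b] b by blast
  next
    \<comment> \<open>Here \<open>s\<close> lies in both covers. Its neighbour outside
      \<open>D\<close> must lie in \<open>C - D\<close> and its neighbour outside \<open>C\<close>
      must be \<open>t\<close>; completeness joins these two, closing a triangle.\<close>
    case True
    obtain b where b: "{s, b} \<in> E" "b \<notin> D" using min_vertex_cover_neighbour[OF G D True] by blast
    have "b \<in> insert t C - {s}" using min_vertex_coverD(3)[OF J b(1)] by blast
    then have bC: "b \<in> C - D" using b t by blast
    obtain c where c: "{s, c} \<in> E" "c \<notin> C" using min_vertex_cover_neighbour[OF G C s] by blast
    have "c = t" using min_vertex_coverD(3)[OF J c(1)] c(2) by blast
    moreover have "{b, t} \<in> E" using cb bC t unfolding complete_between_def by blast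
    moreover have "s \<noteq> b" "s \<noteq> t" "b \<noteq> t" using simple_graph_edge_neq[OF G] b(1) s bC t by blast+
    moreover have "{t, s} \<in> E" using c(1) \<open>c = t\<close> by (simp add: insert_commute)
    ultimately have "distinct [s, b, t] \<and> adj E s b \<and> adj E b t \<and> adj E t s"
      using b(1) by (auto simp: adj_def)
    then show False using T unfolding no_3_cycle_def by blast
  qed
qed

text \<open>The result is wanted for the pair \<open>A\<close>, \<open>B\<close>, but the induction
  passes through intermediate covers. The hypotheses \<open>nested\<close> say that going from
  \<open>C\<close> to \<open>D\<close> drops only vertices of \<open>A\<close> and gains only
  vertices of \<open>B\<close>, and this is inherited by both halves.\<close>

lemma bipartite_matching:
  assumes G: "simple_graph (A \<union> B) E" and disj: "A \<inter> B = {}"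
    and bip: "\<And>x y. {x, y} \<in> E \<Longrightarrow> x \<in> A \<Longrightarrow> y \<in> B" "\<And>x y. {x, y} \<in> E \<Longrightarrow> x \<in> B \<Longrightarrow> y \<in> A"
    and U: "unmixed (A \<union> B) E" and thin: "thin_complete_pairs (A \<union> B) E"
    and C: "min_vertex_cover (A \<union> B) E C" and D: "min_vertex_cover (A \<union> B) E D"
    and nested: "D \<inter> A \<subseteq> C" "C \<inter> B \<subseteq> D"
  shows "\<exists>\<mu>. bij_betw \<mu> (C - D) (D - C) \<and> (\<forall>a\<in>C - D. {a, \<mu> a} \<in> E) \<and>
    (\<forall>a\<in>C - D. \<forall>a'\<in>C - D. {a, \<mu> a'} \<in> E \<and> {a', \<mu> a} \<in> E \<longrightarrow> a = a')"
  using C D nested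
proof (induction "card (C - D)" arbitrary: C D rule: less_induct)
  case less
  let ?V = "A \<union> B"
  note C = less.prems(1) and D = less.prems(2)
  have eqc: "card (X - Y) = card (Y - X)" if "min_vertex_cover ?V E X" "min_vertex_cover ?V E Y" for X Y
    using unmixed_card_diff[OF G U that] .
  have fin: "finite X" if "min_vertex_cover ?V E X" for X
    using min_vertex_coverD(2)[OF that] simple_graph_finite[OF G] by (auto intro: finite_subset)
  have "C \<subseteq> ?V" "D \<subseteq> ?V" using min_vertex_coverD(2) C D by blast+
  consider "card (C - D) = 0" | "card (C - D) = 1" | "card (C - D) > 1" by linarith
  then show ?case
  proof cases
    case 1
    then have "C - D = {}" "D - C = {}"
      using eqc[OF C D] card_0_eq[of "C - D"] card_0_eq[of "D - C"] fin[OF C] fin[OF D] by simp_all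
    then show ?thesis by (auto simp: bij_betw_def)
  next
    case 2
    then obtain a b where ab: "C - D = {a}" "D - C = {b}"
      using eqc[OF C D] by (metis card_1_singletonE)
    obtain y where y: "{a, y} \<in> E" "y \<notin> C" using min_vertex_cover_neighbour[OF G C, of a] ab by blast
    then have "y \<in> D" using min_vertex_coverD(3)[OF D y(1)] ab by blast
    then have "y = b" using y ab by blast
    then show ?thesis using ab y by (intro exI[of _ "\<lambda>_. b"]) (auto simp: bij_betw_def)
  next
    case 3
    obtain a b where ab: "a \<in> C - D" "b \<in> D - C" "{a, b} \<notin> E"
      using thin_complete_pairs_nonadjacent[OF thin C D 3] .
    obtain J where J: "min_vertex_cover ?V E J" "J \<subseteq> C \<union> D - {a, b}"
      using min_vertex_cover_avoiding[OF G C D ab] .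
    \<comment> \<open>A vertex \<open>z\<close> of \<open>C \<inter> D\<close> outside
      \<open>J\<close> would have all its neighbours in \<open>C \<union> D\<close>. One of them
      avoids \<open>D\<close>, so it lies in \<open>A\<close>, and one avoids \<open>C\<close>, so
      it lies in \<open>B\<close>; a vertex of a bipartite graph cannot have both.\<close>
    have sub: "C \<inter> D \<subseteq> J"
    proof
      fix z assume z: "z \<in> C \<inter> D"
      show "z \<in> J"
      proof (rule ccontr)
        assume "z \<notin> J"
        then have nb: "y \<in> C \<union> D" if "{z, y} \<in> E" for y
          using min_vertex_coverD(3)[OF J(1) that] J(2) by blast
        obtain y where y: "{z, y} \<in> E" "y \<notin> D" using min_vertex_cover_neighbour[OF G D, of z] z by blast
        obtain y' where y': "{z, y'} \<in> E" "y' \<notin> C" using min_vertex_cover_neighbour[OF G C, of z] z by blast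
        have "z \<in> A \<or> z \<in> B" using z \<open>C \<subseteq> ?V\<close> by blast
        then show False
          using nb[OF y(1)] nb[OF y'(1)] bip y y' less.prems(3,4) by blast
      qed
    qed
    have nest: "J \<inter> A \<subseteq> C" "C \<inter> B \<subseteq> J" "D \<inter> A \<subseteq> J" "J \<inter> B \<subseteq> D"
      using J(2) sub less.prems(3,4) by blast+
    have "card (J - D) < card (C - D)"
      using J(2) ab fin[OF C] by (intro psubset_card_mono) auto
    from less.hyps[OF this J(1) D nest(3,4)] obtain \<mu>2 where
      \<mu>2: "bij_betw \<mu>2 (J - D) (D - J)" "\<forall>a\<in>J - D. {a, \<mu>2 a} \<in> E"
      "\<forall>a\<in>J - D. \<forall>a'\<in>J - D. {a, \<mu>2 a'} \<in> E \<and> {a', \<mu>2 a} \<in> E \<longrightarrow> a = a'" by blast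
    have "card (J - C) < card (D - C)"
      using J(2) ab fin[OF D] by (intro psubset_card_mono) auto
    then have "card (C - J) < card (C - D)" using eqc[OF C J(1)] eqc[OF C D] by simp
    from less.hyps[OF this C J(1) nest(1,2)] obtain \<mu>1 where
      \<mu>1: "bij_betw \<mu>1 (C - J) (J - C)" "\<forall>a\<in>C - J. {a, \<mu>1 a} \<in> E"
      "\<forall>a\<in>C - J. \<forall>a'\<in>C - J. {a, \<mu>1 a'} \<in> E \<and> {a', \<mu>1 a} \<in> E \<longrightarrow> a = a'" by blast
    define \<mu> where "\<mu> x = (if x \<in> J then \<mu>2 x else \<mu>1 x)" for x
    have split: "C - D = (C - J) \<union> (J - D)" "D - C = (J - C) \<union> (D - J)"
      using sub J(2) by blast+
    have bij: "bij_betw \<mu> (C - D) (D - C)"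
      unfolding split
    proof (rule bij_betw_combine)
      show "bij_betw \<mu> (C - J) (J - C)" using \<mu>1(1) by (subst bij_betw_cong[of _ _ \<mu>1]) (auto simp: \<mu>_def)
      show "bij_betw \<mu> (J - D) (D - J)" using \<mu>2(1) by (subst bij_betw_cong[of _ _ \<mu>2]) (auto simp: \<mu>_def)
      show "(J - C) \<inter> (D - J) = {}" by blast
    qed
    have m1: "\<mu>1 x \<in> J" if "x \<in> C - J" for x using \<mu>1(1) that by (auto simp: bij_betw_def)
    have m2: "\<mu>2 x \<notin> J" if "x \<in> J - D" for x using \<mu>2(1) that by (auto simp: bij_betw_def)
    \<comment> \<open>Both ends would be outside \<open>J\<close>. Hence for \<open>a\<close> and
      \<open>a'\<close> in different halves the premise of antisymmetry never holds.\<close>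
    have cross: "{x, \<mu>2 y} \<notin> E" if "x \<in> C - J" "y \<in> J - D" for x y
      using min_vertex_coverD(3)[OF J(1), of x "\<mu>2 y"] m2[OF that(2)] that by blast
    have "a = a'" if "a \<in> C - D" "a' \<in> C - D" "{a, \<mu> a'} \<in> E" "{a', \<mu> a} \<in> E" for a a'
      using that \<mu>1(3) \<mu>2(3) cross[of a a'] cross[of a' a] unfolding split \<mu>_def by (auto split: if_splits)
    moreover have "{a, \<mu> a} \<in> E" if "a \<in> C - D" for a
      using that \<mu>1(2) \<mu>2(2) unfolding split \<mu>_def by auto
    ultimately show ?thesis using bij by blast
  qed
qed

text \<open>If \<open>a\<close> and \<open>\<mu> a''\<close> were not adjacent, some minimal cover
  would avoid both. It would then contain \<open>a'\<close> and \<open>\<mu> a'\<close>, hence both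
  ends of one matching edge and at least one end of each other, which makes it larger than
  \<open>A\<close>.\<close>

lemma unmixed_matching_transitive:
  assumes G: "simple_graph (A \<union> B) E" and disj: "A \<inter> B = {}" and U: "unmixed (A \<union> B) E"
    and A: "min_vertex_cover (A \<union> B) E A"
    and \<mu>: "bij_betw \<mu> A B" "\<And>a. a \<in> A \<Longrightarrow> {a, \<mu> a} \<in> E"
    and aA: "a \<in> A" "a' \<in> A" "a'' \<in> A" and e: "{a, \<mu> a'} \<in> E" "{a', \<mu> a''} \<in> E"
  shows "{a, \<mu> a''} \<in> E"
proof (rule ccontr)
  assume ne: "{a, \<mu> a''} \<notin> E"
  have finA: "finite A" using simple_graph_finite[OF G] by simp
  have \<mu>B: "\<mu> x \<in> B" if "x \<in> A" for x using \<mu>(1) that by (auto simp: bij_betw_def)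
  have "is_vertex_cover (A \<union> B) E (A \<union> B - {a, \<mu> a''})"
  proof (rule vertex_coverI[OF G])
    fix x y assume xy: "{x, y} \<in> E" "x \<notin> A \<union> B - {a, \<mu> a''}"
    then show "y \<in> A \<union> B - {a, \<mu> a''}"
      using simple_graph_edge_neq[OF G xy(1)] simple_graph_edge_in[OF G xy(1)] ne
      by (auto simp: insert_commute)
  qed auto
  then obtain D where D: "D \<subseteq> A \<union> B - {a, \<mu> a''}" "min_vertex_cover (A \<union> B) E D"
    using simple_graph_finite[OF G] by (rule min_vertex_cover_below)
  have a'D: "a' \<in> D" "\<mu> a' \<in> D"
    using min_vertex_coverD(3)[OF D(2), of "\<mu> a''" a'] min_vertex_coverD(3)[OF D(2) e(1)] D(1) e(2)
    by (auto simp: insert_commute)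
  \<comment> \<open>Matching edges with \<open>A\<close>-end outside \<open>D\<close> are covered in
    \<open>B\<close>; inserting \<open>a'\<close>, which lies in \<open>D\<close>, records the one
    edge that is covered twice.\<close>
  have sub: "\<mu> ` (insert a' (A - D)) \<subseteq> D \<inter> B"
    using min_vertex_coverD(3)[OF D(2) \<mu>(2)] a'D \<mu>B aA by auto
  have "card (insert a' (A - D)) = card (\<mu> ` (insert a' (A - D)))"
    by (rule card_image[symmetric], rule inj_on_subset[OF bij_betw_imp_inj_on[OF \<mu>(1)]]) (use aA in auto)
  also have "\<dots> \<le> card (D \<inter> B)"
    using simple_graph_finite[OF G] by (intro card_mono sub) auto
  finally have "Suc (card (A - D)) \<le> card (D \<inter> B)" using a'D finA by simp
  moreover have "card A = card (A \<inter> D) + card (A - D)"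
    using card_Int_Diff finA by metis
  moreover have "card D = card (A \<inter> D) + card (D \<inter> B)"
  proof -
    have "D = (A \<inter> D) \<union> (D \<inter> B)" using D(1) by blast
    then show ?thesis using card_Un_disjoint[of "A \<inter> D" "D \<inter> B"] disj simple_graph_finite[OF G] by auto
  qed
  moreover have "card D = card A" using U A D(2) unfolding unmixed_def by blast
  ultimately show False by linarith
qed

section \<open>Monomial ideals and Cohen--Macaulay bipartite graphs\<close>

lemma gen_ideal_base: "p \<in> A \<Longrightarrow> p \<in> gen_ideal K V A"
  using gen_ideal_superset[of A K V] by blast

lemma edge_in_edge_ideal: "{a, b} \<in> E \<Longrightarrow> var a * var b \<in> edge_ideal K V E"
  unfolding edge_ideal_def by (rule gen_ideal_base) blast

lemma is_ideal_keys:
  assumes up: "\<And>k l. Q k \<Longrightarrow> Q (l + k)"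
  shows "is_ideal K V {p \<in> polys K V. \<forall>k\<in>keys p. Q k}"
  unfolding is_ideal_def
proof (intro conjI ballI)
  fix p q assume "p \<in> {p \<in> polys K V. \<forall>k\<in>keys p. Q k}" "q \<in> {p \<in> polys K V. \<forall>k\<in>keys p. Q k}"
  then show "p + q \<in> {p \<in> polys K V. \<forall>k\<in>keys p. Q k}" using keys_add[of p q] by blast
next
  fix r p assume "r \<in> polys K V" "p \<in> {p \<in> polys K V. \<forall>k\<in>keys p. Q k}"
  then show "r * p \<in> {p \<in> polys K V. \<forall>k\<in>keys p. Q k}"
    using up by (auto elim!: keys_mult_obtain)
qed auto

text \<open>\<open>Q\<close> describes the exponent vectors in a monomial ideal, and
  \<open>up\<close> is closure under multiplication by monomials. Membership in such an ideal is
  decided term by term.\<close>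

lemma gen_ideal_eq_keys:
  assumes up: "\<And>k l. Q k \<Longrightarrow> Q (l + k)"
    and A: "\<And>p. p \<in> A \<Longrightarrow> p \<in> polys K V \<and> (\<forall>k\<in>keys p. Q k)"
    and gen: "\<And>k c. Q k \<Longrightarrow> keys k \<subseteq> V \<Longrightarrow> single k c \<in> gen_ideal K V A"
  shows "gen_ideal K V A = {p \<in> polys K V. \<forall>k\<in>keys p. Q k}"
proof
  show "gen_ideal K V A \<subseteq> {p \<in> polys K V. \<forall>k\<in>keys p. Q k}"
    using A by (intro gen_ideal_least is_ideal_keys up) auto
  have I: "is_ideal K V (gen_ideal K V A)" using A by (intro is_ideal_gen_ideal) auto
  show "{p \<in> polys K V. \<forall>k\<in>keys p. Q k} \<subseteq> gen_ideal K V A"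
  proof
    fix p assume "p \<in> {p \<in> polys K V. \<forall>k\<in>keys p. Q k}"
    then have "(\<Sum>k\<in>keys p. single k (lookup p k)) \<in> gen_ideal K V A"
      by (intro is_ideal_sum[OF I] gen) (auto dest!: polysD)
    then show "p \<in> gen_ideal K V A" by (simp add: poly_mapping_sum_single)
  qed
qed

lemma gen_ideal_vars:
  assumes "X \<subseteq> V"
  shows "gen_ideal K V (var ` X) = {p \<in> polys K V. \<forall>k\<in>keys p. keys k \<inter> X \<noteq> {}}"
proof (rule gen_ideal_eq_keys)
  have I: "is_ideal K V (gen_ideal K V (var ` X))" using assms by (intro is_ideal_gen_ideal) auto
  fix k :: "'a \<Rightarrow>\<^sub>0 nat" and c :: 'b assume k: "keys k \<inter> X \<noteq> {}" "keys k \<subseteq> V"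
  then obtain v where v: "v \<in> keys k" "v \<in> X" by blast
  have "single (k - single v 1) c \<in> polys K V"
    using keys_minus_nat[of k "single v 1"] k by (intro polys_single) blast
  then have "single (k - single v 1) c * var v \<in> gen_ideal K V (var ` X)"
    by (rule is_idealD(4)[OF I]) (use v(2) in \<open>auto intro: gen_ideal_base\<close>)
  then show "single k c \<in> gen_ideal K V (var ` X)"
    by (simp only: single_factor_var[OF v(1), symmetric])
qed (use assms in \<open>auto simp: keys_plus_nat var_def polys_single\<close>)

text \<open>The case \<open>a = b\<close> serves the squares that appear once matched vertices are
  identified.\<close>

lemma single_factor_two_vars:
  assumes "a \<in> keys k" "b \<in> keys k" "a = b \<longrightarrow> 2 \<le> lookup k a"
  shows "single k c = single (k - single b 1 - single a 1) c * (var a * var b)"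
proof -
  have "a \<in> keys (k - single b 1)"
    using assms by (auto simp: in_keys_iff lookup_minus lookup_single when_def)
  from single_factor_var[OF assms(2), of c] single_factor_var[OF this, of c]
  show ?thesis by (simp add: mult.assoc)
qed

lemma single_in_ideal_two_vars:
  assumes I: "is_ideal K V I" and k: "keys k \<subseteq> V"
    and "a \<in> keys k" "b \<in> keys k" "a = b \<longrightarrow> 2 \<le> lookup k a" "var a * var b \<in> I"
  shows "single k c \<in> I"
proof -
  have "keys (k - single b 1 - single a 1) \<subseteq> V"
    using keys_minus_nat[of k "single b 1"] keys_minus_nat[of "k - single b 1" "single a 1"] k by blast
  then show ?thesis
    unfolding single_factor_two_vars[OF assms(3-5)] by (intro is_idealD(4)[OF I] polys_single assms)
qed

lemma edge_generators_subset_polys: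
  "simple_graph V E \<Longrightarrow> {var a * var b | a b. {a, b} \<in> E} \<subseteq> polys K V"
  using simple_graph_edge_in by (force intro: polys_mult)

lemma is_ideal_edge_ideal: "simple_graph V E \<Longrightarrow> is_ideal K V (edge_ideal K V E)"
  unfolding edge_ideal_def by (intro is_ideal_gen_ideal edge_generators_subset_polys)

lemma edge_ideal_eq:
  assumes G: "simple_graph V E"
  shows "edge_ideal K V E = {p \<in> polys K V. \<forall>k\<in>keys p. \<exists>a b. {a, b} \<in> E \<and> a \<in> keys k \<and> b \<in> keys k}"
  unfolding edge_ideal_def
proof (rule gen_ideal_eq_keys)
  fix k l :: "'a \<Rightarrow>\<^sub>0 nat" assume "\<exists>a b. {a, b} \<in> E \<and> a \<in> keys k \<and> b \<in> keys k"
  then show "\<exists>a b. {a, b} \<in> E \<and> a \<in> keys (l + k) \<and> b \<in> keys (l + k)"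
    by (auto simp: keys_plus_nat)
next
  fix p :: "('a, 'b) mpoly" assume "p \<in> {var a * var b |a b. {a, b} \<in> E}"
  then obtain a b where ab: "p = var a * var b" "{a, b} \<in> E" by blast
  have "keys p = {single a 1 + single b 1}" unfolding ab var_def by (simp add: mult_single)
  then show "p \<in> polys K V \<and> (\<forall>k\<in>keys p. \<exists>a b. {a, b} \<in> E \<and> a \<in> keys k \<and> b \<in> keys k)"
    using ab edge_generators_subset_polys[OF G, of K] by (auto simp: keys_plus_nat)
next
  fix k :: "'a \<Rightarrow>\<^sub>0 nat" and c :: 'b assume "\<exists>a b. {a, b} \<in> E \<and> a \<in> keys k \<and> b \<in> keys k" and k: "keys k \<subseteq> V"
  then obtain a b where ab: "{a, b} \<in> E" "a \<in> keys k" "b \<in> keys k" by blast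
  have "var a * var b \<in> gen_ideal K V {var a * var b |a b. {a, b} \<in> E}"
    using edge_in_edge_ideal[OF ab(1)] unfolding edge_ideal_def .
  then show "single k c \<in> gen_ideal K V {var a * var b |a b. {a, b} \<in> E}"
    using ab simple_graph_edge_neq[OF G ab(1)]
    by (intro single_in_ideal_two_vars[OF is_ideal_gen_ideal[OF edge_generators_subset_polys[OF G]] k]) auto
qed

text \<open>The variables in the smallest prime of a chain form a vertex cover, because that prime
  contains a product of two variables for every edge. The chain is then no longer than the number of
  remaining variables.\<close>

lemma krull_dim_edge_ideal_le:
  assumes G: "simple_graph V E" and n: "\<And>C. is_vertex_cover V E C \<Longrightarrow> card (V - C) \<le> n"
  shows "krull_dim_quot K V (edge_ideal K V E) \<le> enat n"
  unfolding krull_dim_quot_def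
proof (rule Sup_least)
  fix d assume "d \<in> {enat m | m. \<exists>P. (\<forall>i\<le>m. is_prime_ideal K V (P i) \<and> edge_ideal K V E \<subseteq> P i) \<and>
    (\<forall>i<m. P i \<subset> P (Suc i))}"
  then obtain m P where d: "d = enat m"
    and P: "\<And>i. i \<le> m \<Longrightarrow> is_prime_ideal K V (P i) \<and> edge_ideal K V E \<subseteq> P i"
      "\<And>i. i < m \<Longrightarrow> P i \<subset> P (Suc i)" by blast
  define C where "C = {v \<in> V. var v \<in> P 0}"
  have "is_vertex_cover V E C"
  proof (rule vertex_coverI[OF G])
    fix x y assume xy: "{x, y} \<in> E" "x \<notin> C"
    have "var x * var y \<in> P 0" using P(1)[of 0] edge_in_edge_ideal[OF xy(1), of K V] by blast
    then have "var x \<in> P 0 \<or> var y \<in> P 0"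
      using P(1)[of 0] simple_graph_edge_in[OF G xy(1)] by (intro is_prime_idealD(3)[of K V]) auto
    then show "y \<in> C" using xy simple_graph_edge_in[OF G xy(1)] by (auto simp: C_def)
  qed (auto simp: C_def)
  moreover have "m \<le> card (V - C)"
    by (rule prime_chain_length_le[of m K V P])
       (use P simple_graph_finite[OF G] in \<open>auto simp: C_def\<close>)
  ultimately show "d \<le> enat n" using n d by (metis enat_ord_simps(1) le_trans)
qed

text \<open>Pushforward of a finitely supported function. Applied twice,
  \<open>push (push h)\<close> is the ring homomorphism that substitutes the variable
  \<open>h v\<close> for \<open>v\<close>: the inner map renames exponent vectors, the outer one
  acts on polynomials.\<close>

definition push :: "('a \<Rightarrow> 'b) \<Rightarrow> ('a \<Rightarrow>\<^sub>0 'c::comm_monoid_add) \<Rightarrow> ('b \<Rightarrow>\<^sub>0 'c)" where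
  "push f p = (\<Sum>k\<in>keys p. single (f k) (lookup p k))"

lemma push_superset:
  assumes "finite A" "keys p \<subseteq> A"
  shows "push f p = (\<Sum>k\<in>A. single (f k) (lookup p k))"
  unfolding push_def using assms by (intro sum.mono_neutral_left) (auto simp: in_keys_iff)

lemma push_single [simp]: "push f (single k c) = single (f k) c"
  by (simp add: push_def)

lemma push_add: "push f (p + q) = push f p + push f q"
  using keys_add[of p q]
  by (simp add: push_superset[of "keys p \<union> keys q"] lookup_add single_add sum.distrib)

lemma push_0 [simp]: "push f 0 = 0"
  by (simp add: push_def)

lemma push_diff: "push f (p - q :: 'a \<Rightarrow>\<^sub>0 'c::ab_group_add) = push f p - push f q"
  using push_add[of f "p - q" q] by simp

lemma push_mult:
  fixes p q :: "'a::comm_monoid_add \<Rightarrow>\<^sub>0 'c::semiring_0" and f :: "'a \<Rightarrow> 'b::comm_monoid_add"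
  assumes "\<And>k l. f (k + l) = f k + f l"
  shows "push f (p * q) = push f p * push f q"
proof (induction p rule: poly_mapping_additive_induct)
  case (single k c)
  show ?case
    by (induction q rule: poly_mapping_additive_induct)
       (simp_all add: mult_single assms distrib_left push_add)
qed (simp add: distrib_right push_add)

lemma keys_push: "keys (push f p) \<subseteq> f ` keys p"
proof -
  have "keys (push f p) \<subseteq> (\<Union>k\<in>keys p. keys (single (f k) (lookup p k)))"
    unfolding push_def by (rule keys_sum)
  then show ?thesis by (force split: if_splits)
qed

lemma monomial_induct [case_names zero step]:
  assumes "P 0" "\<And>m v. P m \<Longrightarrow> P (m + single v 1)"
  shows "P (m :: 'v \<Rightarrow>\<^sub>0 nat)"
proof -
  have "\<forall>m'. P m' \<longrightarrow> P (m' + m)"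
  proof (induction m rule: poly_mapping_additive_induct)
    case (single v n)
    show ?case
    proof (induction n)
      case (Suc n)
      have "m' + single v (Suc n) = (m' + single v n) + single v 1" for m'
        by (simp add: add.assoc single_add[symmetric])
      then show ?case using Suc assms(2) by auto
    qed auto
  next
    case (add p q)
    then show ?case by (metis add.assoc)
  qed
  then show ?thesis using assms(1) by (metis add_0)
qed

text \<open>The partial order on \<open>A\<close> is given by \<open>a \<le> a'\<close> iff \<open>a\<close> is adjacent to \<open>\<mu> a'\<close>.\<close>

locale poset_bipartite =
  fixes A B :: "'v set" and E :: "'v set set" and \<mu> :: "'v \<Rightarrow> 'v"
  assumes graph: "simple_graph (A \<union> B) E" and disj: "A \<inter> B = {}"
    and edges: "\<And>x y. {x, y} \<in> E \<Longrightarrow> x \<in> A \<and> y \<in> B \<or> x \<in> B \<and> y \<in> A"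
    and bij: "bij_betw \<mu> A B"
    and adj_refl: "\<And>a. a \<in> A \<Longrightarrow> {a, \<mu> a} \<in> E"
    and adj_trans: "\<And>a b c. a \<in> A \<Longrightarrow> b \<in> A \<Longrightarrow> c \<in> A \<Longrightarrow> {a, \<mu> b} \<in> E \<Longrightarrow> {b, \<mu> c} \<in> E \<Longrightarrow> {a, \<mu> c} \<in> E"
    and adj_antisym: "\<And>a b. a \<in> A \<Longrightarrow> b \<in> A \<Longrightarrow> {a, \<mu> b} \<in> E \<Longrightarrow> {b, \<mu> a} \<in> E \<Longrightarrow> a = b"
begin

text \<open>Modulo \<open>var a - var (\<mu> a)\<close> for \<open>a \<in> F\<close> the ring becomes a polynomial ring in the variables
  fixed by \<open>ident F\<close>, and the edge ideal becomes the monomial ideal spanned by the monomials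
  that satisfy \<open>vanishing F\<close>; it is not squarefree, since \<open>a * \<mu> a\<close> turns into \<open>a\<^sup>2\<close>.\<close>

definition ident :: "'v set \<Rightarrow> 'v \<Rightarrow> 'v" where
  "ident F v = (if v \<in> \<mu> ` F then inv_into A \<mu> v else v)"

definition vanishing :: "'v set \<Rightarrow> ('v \<Rightarrow>\<^sub>0 nat) \<Rightarrow> bool" where
  "vanishing F w \<longleftrightarrow> (\<exists>a\<in>A. \<exists>a'\<in>A. {a, \<mu> a'} \<in> E \<and> a \<in> keys w \<and> ident F (\<mu> a') \<in> keys w \<and>
     (a = ident F (\<mu> a') \<longrightarrow> 2 \<le> lookup w a))"

definition ident_gens :: "'k::field itself \<Rightarrow> 'v set \<Rightarrow> ('v, 'k) mpoly set" where
  "ident_gens K F = edge_ideal K (A \<union> B) E \<union> (\<lambda>a. var a - var (\<mu> a)) ` F"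

lemma mu_in: "a \<in> A \<Longrightarrow> \<mu> a \<in> B"
  using bij by (auto simp: bij_betw_def)

lemma mu_inj: "a \<in> A \<Longrightarrow> a' \<in> A \<Longrightarrow> \<mu> a = \<mu> a' \<longleftrightarrow> a = a'"
  using bij by (auto simp: bij_betw_def inj_on_def)

lemma ident_mu: "F \<subseteq> A \<Longrightarrow> a \<in> A \<Longrightarrow> ident F (\<mu> a) = (if a \<in> F then a else \<mu> a)"
  using bij mu_inj by (auto simp: ident_def bij_betw_def)

lemma ident_A: "F \<subseteq> A \<Longrightarrow> a \<in> A \<Longrightarrow> ident F a = a"
  using disj mu_in by (auto simp: ident_def)

lemma ident_in: "F \<subseteq> A \<Longrightarrow> v \<in> A \<union> B \<Longrightarrow> ident F v \<in> A \<union> B"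
proof -
  assume F: "F \<subseteq> A" and v: "v \<in> A \<union> B"
  show ?thesis
  proof (cases "v \<in> A")
    case False
    then obtain a where "a \<in> A" "v = \<mu> a" using v bij by (auto simp: bij_betw_def)
    then show ?thesis using ident_mu[OF F, of a] mu_in by auto
  qed (use ident_A[OF F] in auto)
qed

lemma edgeE:
  assumes "{x, y} \<in> E"
  obtains a a' where "a \<in> A" "a' \<in> A" "{a, \<mu> a'} \<in> E" "x = a \<and> y = \<mu> a' \<or> x = \<mu> a' \<and> y = a"
proof -
  have *: "\<exists>a'\<in>A. z = \<mu> a'" if "z \<in> B" for z using bij that by (auto simp: bij_betw_def)
  show thesis
    using edges[OF assms] *[of x] *[of y] that assms by (metis insert_commute)
qed

lemma vanishing_up: "vanishing F k \<Longrightarrow> vanishing F (l + k)"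
proof -
  assume "vanishing F k"
  then obtain a a' where *: "a \<in> A" "a' \<in> A" "{a, \<mu> a'} \<in> E" "a \<in> keys k" "ident F (\<mu> a') \<in> keys k"
    "a = ident F (\<mu> a') \<longrightarrow> 2 \<le> lookup k a" unfolding vanishing_def by blast
  then show ?thesis unfolding vanishing_def
    by (intro bexI[of _ a] bexI[of _ a']) (auto simp: keys_plus_nat lookup_add)
qed

lemma ident_gens_subset: "F \<subseteq> A \<Longrightarrow> ident_gens K F \<subseteq> polys K (A \<union> B)"
  unfolding ident_gens_def
  using is_idealD(1)[OF is_ideal_edge_ideal[OF graph, of K]] mu_in by (auto intro!: polys_diff)

lemma push_ident_mult:
  "push (push (ident F)) (p * q) = push (push (ident F)) p * push (push (ident F)) q"
  by (rule push_mult) (rule push_add)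

lemma push_ident_polys:
  assumes F: "F \<subseteq> A" and p: "p \<in> polys K (A \<union> B)"
  shows "push (push (ident F)) p \<in> polys K (A \<union> B)"
proof (rule polysI)
  fix m assume "m \<in> keys (push (push (ident F)) p)"
  from subsetD[OF keys_push this] obtain k where k: "k \<in> keys p" "m = push (ident F) k" by blast
  then show "keys m \<subseteq> A \<union> B"
    using keys_push[of "ident F" k] ident_in[OF F] polysD[OF p k(1)] by blast
qed

lemma push_ident_var [simp]: "push (push (ident F)) (var v) = var (ident F v)"
  by (simp add: var_def)

text \<open>Renaming one variable changes it by a generator, up to sign; monomials follow one
  variable at a time, and polynomials by linearity.\<close>

lemma diff_push_ident_in:
  fixes K :: "'k::field itself"
  assumes F: "F \<subseteq> A" and p: "p \<in> polys K (A \<union> B)"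
  shows "p - push (push (ident F)) p \<in> gen_ideal K (A \<union> B) (ident_gens K F)"
proof -
  let ?J = "gen_ideal K (A \<union> B) (ident_gens K F)"
  have J: "is_ideal K (A \<union> B) ?J" by (rule is_ideal_gen_ideal[OF ident_gens_subset[OF F]])
  have v: "var v - var (ident F v) \<in> ?J" if "v \<in> A \<union> B" for v
  proof (cases "v \<in> \<mu> ` F")
    case True
    then obtain a where a: "a \<in> F" "v = \<mu> a" by blast
    have "- (var a - var (\<mu> a)) \<in> ?J"
      by (rule is_ideal_uminus[OF J]) (use a in \<open>auto simp: ident_gens_def intro!: gen_ideal_base\<close>)
    then show ?thesis using a ident_mu[OF F, of a] F by auto
  next
    case False
    then show ?thesis using is_idealD(2)[OF J] by (simp add: ident_def)
  qed
  have m: "keys m \<subseteq> A \<union> B \<longrightarrow> single m (1::'k) - single (push (ident F) m) 1 \<in> ?J" for m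
  proof (induction m rule: monomial_induct)
    case zero
    then show ?case using is_idealD(2)[OF J] by simp
  next
    case (step m v)
    show ?case
    proof
      assume "keys (m + single v 1) \<subseteq> A \<union> B"
      then have mv: "keys m \<subseteq> A \<union> B" "v \<in> A \<union> B" by (auto simp: keys_plus_nat)
      let ?m = "push (ident F) m"
      have "single (m + single v 1) (1::'k) - single (push (ident F) (m + single v 1)) 1 =
        var v * (single m 1 - single ?m 1) + single ?m 1 * (var v - var (ident F v))"
        by (simp add: push_add var_def right_diff_distrib mult_single add.commute)
      also have "\<dots> \<in> ?J"
      proof (intro is_idealD(3)[OF J])
        show "var v * (single m 1 - single ?m 1) \<in> ?J"
          using step mv by (intro is_idealD(4)[OF J]) auto
        have "keys ?m \<subseteq> A \<union> B" using keys_push[of "ident F" m] ident_in[OF F] mv by blast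
        then show "single ?m 1 * (var v - var (ident F v)) \<in> ?J"
          using v mv by (intro is_idealD(4)[OF J] polys_single) auto
      qed
      finally show "single (m + single v 1) (1::'k) - single (push (ident F) (m + single v 1)) 1 \<in> ?J" .
    qed
  qed
  have "p - push (push (ident F)) p =
    (\<Sum>k\<in>keys p. single 0 (lookup p k) * (single k 1 - single (push (ident F) k) 1))"
    by (subst (1) poly_mapping_sum_single[of p, symmetric])
       (simp add: push_def[of "push (ident F)"] sum_subtractf right_diff_distrib mult_single)
  also have "\<dots> \<in> ?J"
    using m polysD[OF p] by (intro is_ideal_sum[OF J] is_idealD(4)[OF J] polys_const) auto
  finally show ?thesis .
qed

text \<open>The right-hand side is the preimage of a monomial ideal, hence an ideal, and it contains
  the generators. Conversely \<open>p\<close> is congruent to its image, and each vanishing monomial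
  is a multiple of an identified edge product.\<close>

lemma ident_ideal_iff:
  fixes K :: "'k::field itself"
  assumes F: "F \<subseteq> A" and p: "p \<in> polys K (A \<union> B)"
  shows "p \<in> gen_ideal K (A \<union> B) (ident_gens K F) \<longleftrightarrow> (\<forall>w\<in>keys (push (push (ident F)) p). vanishing F w)"
proof -
  let ?J = "gen_ideal K (A \<union> B) (ident_gens K F)"
  let ?s = "push (push (ident F)) :: ('v, 'k) mpoly \<Rightarrow> _"
  have J: "is_ideal K (A \<union> B) ?J" by (rule is_ideal_gen_ideal[OF ident_gens_subset[OF F]])
  define L where "L = {p \<in> polys K (A \<union> B). \<forall>w\<in>keys (?s p). vanishing F w}"
  have L: "is_ideal K (A \<union> B) L"
    unfolding is_ideal_def
  proof (intro conjI ballI)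
    fix p q assume "p \<in> L" "q \<in> L"
    then show "p + q \<in> L" using keys_add[of "?s p" "?s q"] by (auto simp: L_def push_add)
  next
    fix r p assume "r \<in> polys K (A \<union> B)" "p \<in> L"
    then show "r * p \<in> L"
      using vanishing_up by (auto simp: L_def push_ident_mult elim!: keys_mult_obtain)
  qed (auto simp: L_def)
  have "{var a * var b | a b. {a, b} \<in> E} \<subseteq> L"
  proof
    fix p :: "('v, 'k) mpoly" assume pe: "p \<in> {var a * var b | a b. {a, b} \<in> E}"
    then obtain x y where xy: "p = var x * var y" "{x, y} \<in> E" by blast
    obtain a a' where a: "a \<in> A" "a' \<in> A" "{a, \<mu> a'} \<in> E" "x = a \<and> y = \<mu> a' \<or> x = \<mu> a' \<and> y = a"
      by (rule edgeE[OF xy(2)])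
    have "p = var a * var (\<mu> a')" using xy(1) a(4) by (auto simp: mult.commute)
    then have "?s p = single (single a 1 + single (ident F (\<mu> a')) 1) 1"
      using ident_A[OF F a(1)] by (simp add: push_ident_mult) (simp add: var_def mult_single)
    moreover have "vanishing F (single a 1 + single (ident F (\<mu> a')) 1)"
      unfolding vanishing_def using a
      by (intro bexI[of _ a] bexI[of _ a']) (auto simp: keys_plus_nat lookup_add)
    ultimately show "p \<in> L"
      using edge_generators_subset_polys[OF graph, of K] pe by (auto simp: L_def)
  qed
  then have "edge_ideal K (A \<union> B) E \<subseteq> L" unfolding edge_ideal_def by (rule gen_ideal_least[OF L])
  moreover have "(\<lambda>a. var a - var (\<mu> a)) ` F \<subseteq> L"
    using F mu_in by (auto simp: L_def push_diff ident_A ident_mu subset_iff intro!: polys_diff)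
  ultimately have "?J \<subseteq> L" by (intro gen_ideal_least[OF L]) (auto simp: ident_gens_def)
  then have only_if: "\<forall>w\<in>keys (?s p). vanishing F w" if "p \<in> ?J" using that by (auto simp: L_def)
  have "p \<in> ?J" if van: "\<forall>w\<in>keys (?s p). vanishing F w"
  proof -
    have "(\<Sum>w\<in>keys (?s p). single w (lookup (?s p) w)) \<in> ?J"
    proof (rule is_ideal_sum[OF J])
      fix w assume w: "w \<in> keys (?s p)"
      then obtain a a' where *: "a \<in> A" "a' \<in> A" "{a, \<mu> a'} \<in> E" "a \<in> keys w" "ident F (\<mu> a') \<in> keys w"
        "a = ident F (\<mu> a') \<longrightarrow> 2 \<le> lookup w a" using van unfolding vanishing_def by blast
      \<comment> \<open>The product after identification differs from the genuine edge generator by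
        a multiple of a variable difference in the ideal.\<close>
      have "var a * var (\<mu> a') - var a * (var (\<mu> a') - var (ident F (\<mu> a'))) \<in> ?J"
      proof (rule is_ideal_diff[OF J])
        show "var a * var (\<mu> a') \<in> ?J"
          by (rule gen_ideal_base) (simp add: ident_gens_def edge_in_edge_ideal[OF *(3)])
        have "var (\<mu> a') - var (ident F (\<mu> a')) \<in> ?J"
          using diff_push_ident_in[OF F, of "var (\<mu> a')" K] mu_in[OF *(2)] by simp
        then show "var a * (var (\<mu> a') - var (ident F (\<mu> a'))) \<in> ?J"
          using *(1) by (intro is_idealD(4)[OF J, of "var a"]) auto
      qed
      then have "var a * var (ident F (\<mu> a')) \<in> ?J" by (simp add: right_diff_distrib)
      then show "single w (lookup (?s p) w) \<in> ?J"
        using single_in_ideal_two_vars[OF J _ *(4-6)] polysD[OF push_ident_polys[OF F p] w] by blast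
    qed
    then have "?s p \<in> ?J" by (simp add: poly_mapping_sum_single)
    from is_idealD(3)[OF J diff_push_ident_in[OF F p] this] show "p \<in> ?J" by simp
  qed
  then show ?thesis using only_if by blast
qed

text \<open>The quotient has no socle in direction \<open>a\<close>: if both \<open>a\<close> and \<open>\<mu> a\<close> annihilate \<open>w\<close>,
  transitivity produces an edge inside \<open>w\<close>.\<close>

lemma vanishing_extend:
  assumes F: "F \<subseteq> A" and a: "a \<in> A" "a \<notin> F"
    and van: "vanishing F (single a 1 + w)" "vanishing F (single (\<mu> a) 1 + w)"
  shows "vanishing F w"
proof (rule ccontr)
  assume nv: "\<not> vanishing F w"
  obtain c c' where c: "c \<in> A" "c' \<in> A" "{c, \<mu> c'} \<in> E" "c \<in> keys (single a 1 + w)"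
    "ident F (\<mu> c') \<in> keys (single a 1 + w)" "c = ident F (\<mu> c') \<longrightarrow> 2 \<le> lookup (single a 1 + w) c"
    using van(1) unfolding vanishing_def by blast
  obtain d d' where d: "d \<in> A" "d' \<in> A" "{d, \<mu> d'} \<in> E" "d \<in> keys (single (\<mu> a) 1 + w)"
    "ident F (\<mu> d') \<in> keys (single (\<mu> a) 1 + w)" "d = ident F (\<mu> d') \<longrightarrow> 2 \<le> lookup (single (\<mu> a) 1 + w) d"
    using van(2) unfolding vanishing_def by blast
  have muA: "\<mu> x \<notin> A" if "x \<in> A" for x using mu_in[OF that] disj by blast
  have ca: "ident F (\<mu> c') \<noteq> a" using ident_mu[OF F c(2)] a muA[OF c(2)] by (auto split: if_splits)
  have c'w: "ident F (\<mu> c') \<in> keys w" using c(5) ca by (auto simp: keys_plus_nat)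
  \<comment> \<open>As \<open>w\<close> does not vanish, the first edge must use the new factor
    \<open>a\<close>. Since \<open>a \<notin> F\<close>, it can enter only as the end in
    \<open>A\<close>; likewise \<open>\<mu> a\<close> enters the second edge only as the end in
    \<open>B\<close>.\<close>
  have "c = a"
  proof (rule ccontr)
    assume "c \<noteq> a"
    then have "c \<in> keys w" "lookup (single a 1 + w) c = lookup w c"
      using c(4) by (auto simp: keys_plus_nat lookup_add lookup_single)
    then show False using nv c c'w unfolding vanishing_def by auto
  qed
  have dw: "d \<in> keys w" "lookup (single (\<mu> a) 1 + w) d = lookup w d"
    using d(1,4) muA[OF a(1)] by (auto simp: keys_plus_nat lookup_add lookup_single when_def)
  have "ident F (\<mu> d') = \<mu> a"
  proof (rule ccontr)
    assume "ident F (\<mu> d') \<noteq> \<mu> a"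
    then have "ident F (\<mu> d') \<in> keys w" using d(5) by (auto simp: keys_plus_nat)
    then show False using nv d dw unfolding vanishing_def by auto
  qed
  then have "d' = a" using ident_mu[OF F d(2)] mu_inj[OF d(2) a(1)] muA[OF a(1)] d(2) by (auto split: if_splits)
  have dc: "{d, \<mu> c'} \<in> E" using adj_trans[OF d(1) a(1) c(2)] d(3) c(3) \<open>d' = a\<close> \<open>c = a\<close> by simp
  \<comment> \<open>The composed edge must not collapse to a square, for which a single factor in
    \<open>w\<close> would be too little; antisymmetry excludes this.\<close>
  have "d \<noteq> ident F (\<mu> c')"
  proof
    assume eq: "d = ident F (\<mu> c')"
    then have "c' \<in> F" "d = c'" using ident_mu[OF F c(2)] d(1) muA[OF c(2)] by (auto split: if_splits)
    then have "a = c'" using adj_antisym[OF a(1) c(2)] c(3) d(3) \<open>c = a\<close> \<open>d' = a\<close> by simp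
    then show False using a \<open>c' \<in> F\<close> by simp
  qed
  then show False using nv dc d(1) c(2) dw(1) c'w unfolding vanishing_def by blast
qed

lemma vanishing_edge: "F \<subseteq> A \<Longrightarrow> a \<in> A \<Longrightarrow> a \<notin> F \<Longrightarrow> a \<in> keys w \<Longrightarrow> \<mu> a \<in> keys w \<Longrightarrow> vanishing F w"
  unfolding vanishing_def using adj_refl[of a] ident_mu[of F a] mu_in[of a] disj
  by (intro bexI[of _ a] bexI[of _ a]) auto

text \<open>The coefficients of \<open>var a * G\<close> and \<open>var (\<mu> a) * G\<close> agree
  at non-vanishing monomials. If \<open>w\<close> in \<open>G\<close> does not vanish, then
  \<open>w\<close> times \<open>a\<close> or times \<open>\<mu> a\<close> does not vanish either.
  That product cannot contain both variables, so one coefficient is that of \<open>w\<close> in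
  \<open>G\<close> and the other is zero.\<close>

lemma ident_regular:
  fixes K :: "'k::field itself"
  assumes F: "F \<subseteq> A" and a: "a \<in> A" "a \<notin> F" and g: "g \<in> polys K (A \<union> B)"
    and J: "(var a - var (\<mu> a)) * g \<in> gen_ideal K (A \<union> B) (ident_gens K F)"
  shows "g \<in> gen_ideal K (A \<union> B) (ident_gens K F)"
proof -
  define G where "G = push (push (ident F)) g"
  have xy: "a \<in> A \<union> B" "\<mu> a \<in> A \<union> B" "a \<noteq> \<mu> a" using a mu_in[OF a(1)] disj by auto
  have "(var a - var (\<mu> a)) * g \<in> polys K (A \<union> B)" using g xy by (intro polys_mult polys_diff) auto
  then have "\<forall>w\<in>keys (push (push (ident F)) ((var a - var (\<mu> a)) * g)). vanishing F w"
    using ident_ideal_iff[OF F] J by blast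
  then have van: "lookup (var a * G) w = lookup (var (\<mu> a) * G) w" if "\<not> vanishing F w" for w
    using that ident_A[OF F a(1)] ident_mu[OF F a(1)] a(2)
    by (auto simp: push_ident_mult push_diff G_def left_diff_distrib in_keys_iff lookup_minus)
  have shift: "lookup (var x * G) (single x 1 + w) = lookup G w" for x w
    unfolding var_def by (simp add: lookup_single_mult_plus)
  have zero: "lookup (var x * G) w = 0" if "x \<notin> keys w" for x w
    unfolding var_def using that by (intro lookup_single_mult_eq_0) (auto simp: keys_plus_nat)
  have "vanishing F w" if w: "w \<in> keys G" for w
  proof (rule ccontr)
    assume nv: "\<not> vanishing F w"
    have Gw: "lookup G w \<noteq> 0" using w by (simp add: in_keys_iff)
    from vanishing_extend[OF F a] nv consider "\<not> vanishing F (single a 1 + w)" | "\<not> vanishing F (single (\<mu> a) 1 + w)"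
      by blast
    then show False
    proof cases
      case 1
      then have "\<mu> a \<notin> keys (single a 1 + w)" using vanishing_edge[OF F a] by (auto simp: keys_plus_nat)
      then show False using van[OF 1] shift[of a w] zero Gw by simp
    next
      case 2
      then have "a \<notin> keys (single (\<mu> a) 1 + w)" using vanishing_edge[OF F a] by (auto simp: keys_plus_nat)
      then show False using van[OF 2] shift[of "\<mu> a" w] zero Gw by simp
    qed
  qed
  then show ?thesis using ident_ideal_iff[OF F g] by (simp add: G_def)
qed

lemma regular_seq_matching:
  fixes K :: "'k::field itself"
  assumes as: "distinct as" "set as = A"
  shows "regular_seq K (A \<union> B) (edge_ideal K (A \<union> B) E) (map (\<lambda>a. var a - var (\<mu> a)) as)"
  unfolding regular_seq_def
proof (intro conjI allI impI ballI)
  let ?f = "\<lambda>a. var a - var (\<mu> a) :: ('v, 'k) mpoly"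
  have gens: "edge_ideal K (A \<union> B) E \<union> set (take i (map ?f as)) = ident_gens K (set (take i as))" for i
    by (simp add: ident_gens_def take_map)
  have M: "is_ideal K (A \<union> B) (max_hom_ideal K (A \<union> B))"
    unfolding max_hom_ideal_def by (rule is_ideal_gen_ideal) auto
  have "var v \<in> max_hom_ideal K (A \<union> B)" if "v \<in> A \<union> B" for v
    unfolding max_hom_ideal_def using that by (intro gen_ideal_base) auto
  then have "?f a \<in> max_hom_ideal K (A \<union> B)" if "a \<in> A" for a
    using that mu_in[OF that] by (simp add: is_ideal_diff[OF M])
  then show "set (map ?f as) \<subseteq> max_hom_ideal K (A \<union> B)" using as(2) by auto
  fix i g assume i: "i < length (map ?f as)" and g: "g \<in> polys K (A \<union> B)"
    and *: "map ?f as ! i * g \<in> gen_ideal K (A \<union> B) (edge_ideal K (A \<union> B) E \<union> set (take i (map ?f as)))"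
  have "set (take i as) \<subseteq> A" using as(2) set_take_subset[of i as] by simp
  moreover have "as ! i \<in> A" using as(2) i by auto
  moreover have "as ! i \<notin> set (take i as)"
    using as(1) i by (auto simp: in_set_conv_nth nth_eq_iff_index_eq)
  moreover have "?f (as ! i) * g \<in> gen_ideal K (A \<union> B) (ident_gens K (set (take i as)))"
    using * i unfolding gens by simp
  ultimately show "g \<in> gen_ideal K (A \<union> B) (edge_ideal K (A \<union> B) E \<union> set (take i (map ?f as)))"
    unfolding gens using ident_regular[OF _ _ _ g] by blast
next
  \<comment> \<open>Identification fixes 1, whose only exponent vector is 0, and this contains no
    edge.\<close>
  have "1 \<notin> gen_ideal K (A \<union> B) (ident_gens K A)"
    using ident_ideal_iff[of A 1 K] by (auto simp: vanishing_def single_one[symmetric] simp del: single_one)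
  then show "1 \<notin> gen_ideal K (A \<union> B) (edge_ideal K (A \<union> B) E \<union> set (map (\<lambda>a. var a - var (\<mu> a)) as))"
    using as by (simp add: ident_gens_def)
qed

text \<open>Complements of covers have at most \<open>card A\<close> vertices, so dimension is at
  most \<open>card A\<close>. The matching gives a regular sequence of that length, and depth never
  exceeds dimension.\<close>

lemma cohen_macaulay:
  assumes "\<And>C. is_vertex_cover (A \<union> B) E C \<Longrightarrow> card A \<le> card C"
  shows "cohen_macaulay_graph K (A \<union> B) E"
  unfolding cohen_macaulay_graph_def cohen_macaulay_quot_def
proof (rule order.antisym)
  show "depth_quot K (A \<union> B) (edge_ideal K (A \<union> B) E) \<le> krull_dim_quot K (A \<union> B) (edge_ideal K (A \<union> B) E)"
    by (rule depth_quot_le_krull_dim_quot[OF is_idealD(1)[OF is_ideal_edge_ideal[OF graph]]])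
  have fin: "finite A" "finite B" using simple_graph_finite[OF graph] by auto
  have "card (A \<union> B - C) \<le> card A" if "is_vertex_cover (A \<union> B) E C" for C
  proof -
    have "C \<subseteq> A \<union> B" using that by (auto simp: is_vertex_cover_def)
    then have "card (A \<union> B - C) = card (A \<union> B) - card C" using fin by (intro card_Diff_subset) (auto intro: finite_subset)
    also have "card (A \<union> B) = card A + card A"
      using fin disj bij_betw_same_card[OF bij] by (simp add: card_Un_disjoint)
    finally show ?thesis using assms[OF that] by simp
  qed
  then have "krull_dim_quot K (A \<union> B) (edge_ideal K (A \<union> B) E) \<le> enat (card A)"
    by (rule krull_dim_edge_ideal_le[OF graph])
  also obtain as where as: "distinct as" "set as = A" using finite_distinct_list[OF fin(1)] by blast
  have "enat (card A) \<le> depth_quot K (A \<union> B) (edge_ideal K (A \<union> B) E)"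
    unfolding depth_quot_def using regular_seq_matching[OF as, of K] as
    by (intro Sup_upper) (auto simp: distinct_card[symmetric] intro!: exI[of _ "map (\<lambda>a. var a - var (\<mu> a)) as"])
  finally show "krull_dim_quot K (A \<union> B) (edge_ideal K (A \<union> B) E) \<le> depth_quot K (A \<union> B) (edge_ideal K (A \<union> B) E)" .
qed

end

section \<open>Complete bipartite graphs\<close>

lemma mono_deg_superset:
  assumes "finite S" "keys m \<subseteq> S"
  shows "mono_deg m = (\<Sum>v\<in>S. lookup m v)"
  unfolding mono_deg_def using assms by (intro sum.mono_neutral_left) (auto simp: in_keys_iff)

lemma mono_deg_add: "mono_deg (m + n) = mono_deg m + mono_deg n"
  by (simp add: mono_deg_superset[of "keys m \<union> keys n"] keys_plus_nat lookup_add sum.distrib)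

lemma mono_deg_eq_0_iff: "mono_deg m = 0 \<longleftrightarrow> m = 0"
  by (auto simp: mono_deg_def in_keys_iff intro!: poly_mapping_eqI)

lemma keys_var [simp]: "keys (var v) = {single v 1}"
  by (simp add: var_def)

lemma lookup_mult_var_plus: "lookup (var v * p) (single v 1 + k) = lookup p k"
  unfolding var_def by (simp add: lookup_single_mult_plus)

text \<open>Among the terms of \<open>q\<close> without variables from \<open>X\<close>, one of
  least degree survives multiplication: any other way to produce it would use a term of smaller
  degree that also avoids \<open>X\<close>. So \<open>p\<close> acts like a unit, which replaces
  passing to a local ring.\<close>

lemma keys_mult_unit_avoid:
  fixes p q :: "('v, 'k::field) mpoly"
  assumes p: "lookup p 0 \<noteq> 0" and w0: "w0 \<in> keys q" "keys w0 \<inter> X = {}"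
  obtains w where "w \<in> keys (p * q)" "keys w \<inter> X = {}"
proof -
  obtain w where w: "w \<in> keys q" "keys w \<inter> X = {}"
    and min: "\<And>v. v \<in> keys q \<Longrightarrow> keys v \<inter> X = {} \<Longrightarrow> mono_deg w \<le> mono_deg v"
    using ex_has_least_nat[of "\<lambda>w. w \<in> keys q \<and> keys w \<inter> X = {}" w0 mono_deg] w0 by blast
  define p' where "p' = p - single 0 (lookup p 0)"
  have "w \<notin> keys (p' * q)"
  proof
    assume "w \<in> keys (p' * q)"
    then obtain u v where uv: "w = u + v" "u \<in> keys p'" "v \<in> keys q" by (rule keys_mult_obtain)
    have "u \<noteq> 0" using uv(2) by (auto simp: p'_def in_keys_iff lookup_minus)
    then have "mono_deg v < mono_deg w" using uv(1) mono_deg_eq_0_iff[of u] by (simp add: mono_deg_add)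
    moreover have "keys v \<inter> X = {}" using w(2) uv(1) by (auto simp: keys_plus_nat)
    ultimately show False using min[OF uv(3)] by simp
  qed
  moreover have "p * q = single 0 (lookup p 0) * q + p' * q" by (simp add: p'_def algebra_simps)
  moreover have "lookup (single 0 (lookup p 0) * q) w = lookup p 0 * lookup q w"
    using lookup_single_mult_plus[of 0 "lookup p 0" q w] by simp
  ultimately have "w \<in> keys (p * q)" using p w(1) by (simp add: in_keys_iff lookup_add)
  then show thesis using that w(2) by blast
qed

lemma split_by_keys:
  fixes p :: "'a \<Rightarrow>\<^sub>0 'b::comm_monoid_add"
  obtains p1 p2 where "p = p1 + p2" "keys p1 \<subseteq> {k \<in> keys p. S k}" "keys p2 \<subseteq> {k \<in> keys p. \<not> S k}"
proof -
  define q where "q T = (\<Sum>k\<in>{k \<in> keys p. T k}. single k (lookup p k))" for T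
  have keysq: "keys (q T) \<subseteq> {k \<in> keys p. T k}" for T
    unfolding q_def by (rule order.trans[OF keys_sum]) (auto split: if_splits)
  have "p = q S + q (\<lambda>k. \<not> S k)"
    unfolding q_def
    by (subst poly_mapping_sum_single[of p, symmetric], subst sum.union_disjoint[symmetric])
       (auto intro!: sum.cong)
  then show thesis using that keysq by blast
qed

text \<open>Fed into \<open>regular_seq_prime_chain\<close>, this produces a chain of three primes
  above the variables in \<open>X\<close> without proving any explicit ideal prime.\<close>

lemma regular_seq_vars:
  assumes X: "X \<subseteq> V" and b: "b1 \<in> V - X" "b2 \<in> V - X" "b1 \<noteq> b2"
  shows "regular_seq K V (var ` X) [var b1, var b2]"
  unfolding regular_seq_def
proof (intro conjI allI impI ballI)
  show "set [var b1, var b2] \<subseteq> max_hom_ideal K V"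
    unfolding max_hom_ideal_def using b by (auto intro!: gen_ideal_base)
  have *: "g \<in> gen_ideal K V (var ` Y)"
    if "Y \<subseteq> V" "b \<notin> Y" "g \<in> polys K V" "var b * g \<in> gen_ideal K V (var ` Y)" for Y b g
  proof -
    have "keys k \<inter> Y \<noteq> {}" if k: "k \<in> keys g" for k
    proof -
      have "single b 1 + k \<in> keys (var b * g)" using k by (simp add: in_keys_iff lookup_mult_var_plus[unfolded One_nat_def])
      then have "keys (single b 1 + k) \<inter> Y \<noteq> {}"
        using \<open>var b * g \<in> _\<close> unfolding gen_ideal_vars[OF \<open>Y \<subseteq> V\<close>] by blast
      then show ?thesis using \<open>b \<notin> Y\<close> by (auto simp: keys_plus_nat)
    qed
    then show ?thesis unfolding gen_ideal_vars[OF \<open>Y \<subseteq> V\<close>] using that(3) by blast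
  qed
  fix i g assume i: "i < length [var b1, var b2]" and g: "g \<in> polys K V"
    and g': "[var b1, var b2] ! i * g \<in> gen_ideal K V (var ` X \<union> set (take i [var b1, var b2]))"
  consider "i = 0" | "i = 1" using i by fastforce
  then show "g \<in> gen_ideal K V (var ` X \<union> set (take i [var b1, var b2]))"
  proof cases
    case 1
    then show ?thesis using *[of X b1 g] g g' X b by auto
  next
    case 2
    then show ?thesis using *[of "insert b1 X" b2 g] g g' X b by auto
  qed
next
  have "1 \<notin> gen_ideal K V (var ` (insert b2 (insert b1 X)))"
    using X b by (subst gen_ideal_vars) auto
  then show "1 \<notin> gen_ideal K V (var ` X \<union> set [var b1, var b2])" by (simp add: insert_commute)
qed

context
  fixes A B :: "'v set" and E :: "'v set set" and K :: "'k::field itself"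
  assumes graph: "simple_graph (A \<union> B) E" and disj: "A \<inter> B = {}"
    and edges: "\<And>x y. {x, y} \<in> E \<longleftrightarrow> x \<in> A \<and> y \<in> B \<or> x \<in> B \<and> y \<in> A"
begin

lemma complete_bipartite_edge_ideal:
  "p \<in> edge_ideal K (A \<union> B) E \<longleftrightarrow>
     p \<in> polys K (A \<union> B) \<and> (\<forall>k\<in>keys p. keys k \<inter> A \<noteq> {} \<and> keys k \<inter> B \<noteq> {})"
  unfolding edge_ideal_eq[OF graph] edges by blast

text \<open>For \<open>f\<close> the first element of a regular sequence, split \<open>f = \<alpha> + \<beta>\<close> with \<open>\<alpha> \<in> (A)\<close> and
  \<open>\<beta> \<in> (B)\<close>: every element of the maximal ideal multiplies \<open>\<alpha>\<close> into \<open>I + (f)\<close>, although \<open>\<alpha>\<close> is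
  not in it.\<close>

lemma complete_bipartite_regular_seq_length:
  assumes ne: "a0 \<in> A" "b0 \<in> B" and fs: "regular_seq K (A \<union> B) (edge_ideal K (A \<union> B) E) fs"
  shows "length fs \<le> 1"
proof (rule ccontr)
  let ?I = "edge_ideal K (A \<union> B) E" and ?S = "polys K (A \<union> B)"
  note inI = complete_bipartite_edge_ideal
  have I: "is_ideal K (A \<union> B) ?I" by (rule is_ideal_edge_ideal[OF graph])
  assume "\<not> length fs \<le> 1"
  then have len: "0 < length fs" "1 < length fs" by auto
  define f where "f = fs ! 0"
  define g where "g = fs ! 1"
  have max: "p \<in> ?S \<and> (\<forall>k\<in>keys p. keys k \<inter> (A \<union> B) \<noteq> {})" if "p \<in> set fs" for p
    using fs that unfolding regular_seq_def max_hom_ideal_def gen_ideal_vars[OF subset_refl] by blast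
  have f: "f \<in> ?S" "\<forall>k\<in>keys f. keys k \<inter> (A \<union> B) \<noteq> {}"
    and g: "g \<in> ?S" "\<forall>k\<in>keys g. keys k \<inter> (A \<union> B) \<noteq> {}"
    using max[of f] max[of g] len by (auto simp: f_def g_def)
  have take1: "take 1 fs = [f]" using len by (cases fs) (auto simp: f_def)
  have reg1: "h \<in> ?I" if "h \<in> ?S" "f * h \<in> ?I" for h
    using fs len(1) that unfolding regular_seq_def f_def
    by (metis I Un_empty_right empty_set gen_ideal_of_ideal take0)
  have reg2: "h \<in> gen_ideal K (A \<union> B) (insert f ?I)" if "h \<in> ?S" "g * h \<in> gen_ideal K (A \<union> B) (insert f ?I)" for h
  proof -
    have "?I \<union> set (take 1 fs) = insert f ?I" using take1 by simp
    then show ?thesis using fs len(2) that unfolding regular_seq_def g_def by metis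
  qed
  obtain \<alpha> \<beta> where ab: "f = \<alpha> + \<beta>" "keys \<alpha> \<subseteq> {k \<in> keys f. keys k \<inter> A \<noteq> {}}"
    "keys \<beta> \<subseteq> {k \<in> keys f. \<not> keys k \<inter> A \<noteq> {}}" by (rule split_by_keys)
  obtain \<gamma> \<delta> where cd: "g = \<gamma> + \<delta>" "keys \<gamma> \<subseteq> {k \<in> keys g. keys k \<inter> A \<noteq> {}}"
    "keys \<delta> \<subseteq> {k \<in> keys g. \<not> keys k \<inter> A \<noteq> {}}" by (rule split_by_keys)
  have S: "\<alpha> \<in> ?S" "\<beta> \<in> ?S" "\<gamma> \<in> ?S" "\<delta> \<in> ?S"
    using ab cd polysD[OF f(1)] polysD[OF g(1)] by (intro polysI; blast)+
  have kA: "keys k \<inter> A \<noteq> {}" if "k \<in> keys \<alpha> \<or> k \<in> keys \<gamma>" for k using ab cd that by blast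
  have kB: "keys k \<inter> B \<noteq> {}" if "k \<in> keys \<beta> \<or> k \<in> keys \<delta>" for k using ab cd f(2) g(2) that by blast
  have prod: "p * q \<in> ?I" if "p \<in> ?S" "q \<in> ?S" "\<forall>k\<in>keys p. keys k \<inter> A \<noteq> {}" "\<forall>k\<in>keys q. keys k \<inter> B \<noteq> {}" for p q
    unfolding inI using that by (auto elim!: keys_mult_obtain simp: keys_plus_nat Int_Un_distrib2)
  have varI: "var v \<notin> ?I" for v
    unfolding inI using disj by (auto simp: var_def)
  have "\<alpha> * \<delta> - \<gamma> * \<beta> \<in> ?I" using S kA kB by (intro is_ideal_diff[OF I] prod) auto
  \<comment> \<open>So \<open>g\<close> times \<open>\<alpha>\<close> lies in
    \<open>I + (f)\<close>, and regularity of \<open>g\<close> puts \<open>\<alpha>\<close> itself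
    there.\<close>
  moreover have "g * \<alpha> = (\<alpha> * \<delta> - \<gamma> * \<beta>) + \<gamma> * f" unfolding ab(1) cd(1) by (simp add: algebra_simps)
  ultimately have "g * \<alpha> \<in> gen_ideal K (A \<union> B) (insert f ?I)"
    unfolding gen_ideal_insert[OF I f(1)] using S by blast
  then have "\<alpha> \<in> gen_ideal K (A \<union> B) (insert f ?I)" using reg2 S by blast
  then obtain i h where ih: "\<alpha> = i + h * f" "i \<in> ?I" "h \<in> ?S"
    unfolding gen_ideal_insert[OF I f(1)] by blast
  have ik: "keys k \<inter> A \<noteq> {}" "keys k \<inter> B \<noteq> {}" if "k \<in> keys i" for k using ih(2) that unfolding inI by auto
  have "(1 - h) * \<alpha> = \<alpha> - h * f + h * \<beta>" unfolding ab(1) by (simp add: algebra_simps)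
  then have eq: "(1 - h) * \<alpha> = i + h * \<beta>" using ih(1) by simp
  have mA: "keys k \<inter> A \<noteq> {}" if "k \<in> keys ((1 - h) * \<alpha>)" for k
    using that kA by (auto elim!: keys_mult_obtain simp: keys_plus_nat Int_Un_distrib2)
  have mB: "keys k \<inter> B \<noteq> {}" if "k \<in> keys (h * \<beta>)" for k
    using that kB by (auto elim!: keys_mult_obtain simp: keys_plus_nat Int_Un_distrib2)
  show False
  \<comment> \<open>One of \<open>h\<close> and \<open>1 - h\<close> has a non-zero constant term.
    In \<open>(1 - h) * \<alpha> = i + h * \<beta>\<close> it would preserve a term free of
    \<open>A\<close> on the right or free of \<open>B\<close> on the left, which the other summands
    cannot match. If no such term exists to begin with, a variable multiplies \<open>f\<close> into
    \<open>I\<close>, against regularity of \<open>f\<close>.\<close>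
  proof (cases "lookup h 0 = 0")
    case False
    show False
    proof (cases "\<beta> = 0")
      case True
      have "f * var b0 \<in> ?I" using ab(1) True S kA ne by (intro prod) auto
      then show False using reg1[of "var b0"] ne varI by auto
    next
      case nz: False
      then obtain w where "w \<in> keys \<beta>" "keys w \<inter> A = {}" using ab(3) keys_eq_empty[of \<beta>] by blast
      then obtain k where k: "k \<in> keys (h * \<beta>)" "keys k \<inter> A = {}" using keys_mult_unit_avoid[OF False] by blast
      have "h * \<beta> = (1 - h) * \<alpha> - i" using eq by simp
      then have "k \<in> keys ((1 - h) * \<alpha>) \<or> k \<in> keys i" using k(1) keys_diff[of "(1 - h) * \<alpha>" i] by auto
      then show False using mA ik(1) k(2) by blast
    qed
  next
    case True
    show False
    proof (cases "\<exists>w\<in>keys \<alpha>. keys w \<inter> B = {}")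
      case False
      then have "\<alpha> \<in> ?I" unfolding inI using S kA by blast
      moreover have "var a0 * \<beta> \<in> ?I" using S kB ne by (intro prod) auto
      ultimately have "var a0 * \<alpha> + var a0 * \<beta> \<in> ?I"
        using ne by (intro is_idealD(3)[OF I] is_idealD(4)[OF I, of "var a0" \<alpha>]) auto
      then have "f * var a0 \<in> ?I" unfolding ab(1) by (simp add: algebra_simps)
      then show False using reg1[of "var a0"] ne varI by auto
    next
      case w: True
      have "lookup (1 - h) 0 \<noteq> 0" using True by (simp add: lookup_minus)
      then obtain k where k: "k \<in> keys ((1 - h) * \<alpha>)" "keys k \<inter> B = {}"
        using keys_mult_unit_avoid w by metis
      then have "k \<in> keys i \<or> k \<in> keys (h * \<beta>)" using eq keys_add[of i "h * \<beta>"] by auto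
      then show False using ik(2) mB k(2) by blast
    qed
  qed
qed

lemma complete_bipartite_not_cohen_macaulay:
  assumes ne: "A \<noteq> {}" and B: "b1 \<in> B" "b2 \<in> B" "b1 \<noteq> b2"
  shows "\<not> cohen_macaulay_graph K (A \<union> B) E"
proof
  let ?I = "edge_ideal K (A \<union> B) E"
  assume "cohen_macaulay_graph K (A \<union> B) E"
  then have "depth_quot K (A \<union> B) ?I = krull_dim_quot K (A \<union> B) ?I"
    by (simp add: cohen_macaulay_graph_def cohen_macaulay_quot_def)
  moreover have "depth_quot K (A \<union> B) ?I \<le> enat 1"
    unfolding depth_quot_def
    by (rule Sup_least) (use complete_bipartite_regular_seq_length[OF _ B(1)] ne in auto)
  moreover have "enat 2 \<le> krull_dim_quot K (A \<union> B) ?I"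
  proof -
    \<comment> \<open>The edge ideal lies in the ideal of the variables in \<open>A\<close>, so
      primes above the latter witness dimension at least 2.\<close>
    have "regular_seq K (A \<union> B) (var ` A) [var b1, var b2]"
      using B disj by (intro regular_seq_vars) auto
    moreover have "var ` A \<subseteq> polys K (A \<union> B)" by auto
    ultimately obtain P where
      P: "\<forall>i\<le>2. is_prime_ideal K (A \<union> B) (P i) \<and> var ` A \<subseteq> P i" "\<forall>i<2. P i \<subset> P (Suc i)"
      using regular_seq_prime_chain[of K "A \<union> B" "var ` A" "[var b1, var b2]"] by (auto simp: numeral_2_eq_2)
    have "?I \<subseteq> gen_ideal K (A \<union> B) (var ` A)"
      unfolding gen_ideal_vars[OF Un_upper1] using complete_bipartite_edge_ideal by blast
    moreover have "gen_ideal K (A \<union> B) (var ` A) \<subseteq> P i" if "i \<le> 2" for i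
      using P(1) that by (intro gen_ideal_least) (auto simp: is_prime_ideal_def)
    ultimately have "\<forall>i\<le>2. is_prime_ideal K (A \<union> B) (P i) \<and> ?I \<subseteq> P i" using P(1) by blast
    then show ?thesis unfolding krull_dim_quot_def using P(2)
      by (intro Sup_upper CollectI exI[of _ 2] conjI exI[of _ P]) auto
  qed
  ultimately have "enat 2 \<le> enat 1" using order.trans by metis
  then show False by simp
qed

end

section \<open>Syzygies of cover ideals\<close>

definition ind_mon :: "'v set \<Rightarrow> ('v \<Rightarrow>\<^sub>0 nat)" where
  "ind_mon C = (\<Sum>t\<in>C. single t 1)"

lemma lookup_ind_mon: "finite C \<Longrightarrow> lookup (ind_mon C) t = (if t \<in> C then 1 else 0)"
  by (simp add: ind_mon_def lookup_sum lookup_single when_def sum.delta)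

lemma keys_ind_mon: "finite C \<Longrightarrow> keys (ind_mon C) = C"
  by (auto simp: in_keys_iff lookup_ind_mon split: if_splits)

lemma mono_deg_ind_mon: "finite C \<Longrightarrow> mono_deg (ind_mon C) = card C"
  by (simp add: mono_deg_def keys_ind_mon lookup_ind_mon)

lemma cover_monomial_eq_single:
  assumes "finite C"
  shows "cover_monomial C = single (ind_mon C) 1"
  using assms unfolding cover_monomial_def ind_mon_def
  by (induction C) (simp_all add: var_def mult_single)

lemma ind_mon_plus_diff:
  assumes "finite C" "C \<subseteq> keys m"
  shows "ind_mon C + (m - ind_mon C) = m"
proof (rule poly_mapping_eqI)
  fix t
  show "lookup (ind_mon C + (m - ind_mon C)) t = lookup m t"
    using assms by (cases "t \<in> C") (auto simp: lookup_add lookup_minus lookup_ind_mon in_keys_iff subset_iff Suc_le_eq)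
qed

text \<open>Subtraction of exponents is truncated, so divisibility by the cover monomial must be
  tested separately.\<close>

lemma lookup_mult_cover_monomial:
  fixes p :: "('v, 'k::field) mpoly"
  assumes "finite C"
  shows "lookup (p * cover_monomial C) m = (if C \<subseteq> keys m then lookup p (m - ind_mon C) else 0)"
proof (cases "C \<subseteq> keys m")
  case True
  have "lookup (single (ind_mon C) 1 * p) (ind_mon C + (m - ind_mon C)) = lookup p (m - ind_mon C)"
    by (simp add: lookup_single_mult_plus)
  then show ?thesis
    using True assms by (simp add: ind_mon_plus_diff cover_monomial_eq_single mult.commute)
next
  case False
  have "lookup (single (ind_mon C) 1 * p) m = 0"
    by (rule lookup_single_mult_eq_0) (use False assms in \<open>auto simp: keys_plus_nat keys_ind_mon\<close>)
  then show ?thesis using False assms by (simp add: cover_monomial_eq_single mult.commute)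
qed

lemma module_spanE:
  assumes "x \<in> module_span K V B"
  obtains n :: nat and c b where "x = (\<lambda>j. \<Sum>i<n. c i * b i j)" "\<forall>i<n. c i \<in> polys K V \<and> b i \<in> B"
  using assms unfolding module_span_def by blast

lemma module_span_0: "(\<lambda>j. 0) \<in> module_span K V B"
  unfolding module_span_def
  by (intro CollectI exI[of _ 0] exI[of _ "\<lambda>_. 0"] exI[of _ "\<lambda>_. undefined"]) simp

lemma sum_lessThan_plus_shift:
  fixes f :: "nat \<Rightarrow> 'a::comm_monoid_add"
  shows "(\<Sum>i<n + m. f i) = (\<Sum>i<n. f i) + (\<Sum>i<m. f (n + i))"
  by (induction m) (simp_all add: add.assoc)

lemma module_span_add:
  assumes "x \<in> module_span K V B" "y \<in> module_span K V B"
  shows "(\<lambda>j. x j + y j) \<in> module_span K V B"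
proof -
  obtain n :: nat and c b where x: "x = (\<lambda>j. \<Sum>i<n. c i * b i j)" "\<forall>i<n. c i \<in> polys K V \<and> b i \<in> B"
    using assms(1) by (rule module_spanE)
  obtain m :: nat and d e where y: "y = (\<lambda>j. \<Sum>i<m. d i * e i j)" "\<forall>i<m. d i \<in> polys K V \<and> e i \<in> B"
    using assms(2) by (rule module_spanE)
  define c' where "c' i = (if i < n then c i else d (i - n))" for i
  define b' where "b' i = (if i < n then b i else e (i - n))" for i
  have "(\<lambda>j. x j + y j) = (\<lambda>j. \<Sum>i<n + m. c' i * b' i j)"
    unfolding x y sum_lessThan_plus_shift by (simp add: c'_def b'_def)
  moreover have "\<forall>i<n + m. c' i \<in> polys K V \<and> b' i \<in> B"
    using x(2) y(2) by (auto simp: c'_def b'_def)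
  ultimately show ?thesis unfolding module_span_def
    by (intro CollectI exI[of _ "n + m"] exI[of _ c'] exI[of _ b'] conjI)
qed

lemma module_span_scale:
  assumes "x \<in> module_span K V B" "r \<in> polys K V"
  shows "(\<lambda>j. r * x j) \<in> module_span K V B"
proof -
  obtain n :: nat and c b where x: "x = (\<lambda>j. \<Sum>i<n. c i * b i j)" "\<forall>i<n. c i \<in> polys K V \<and> b i \<in> B"
    using assms(1) by (rule module_spanE)
  have "(\<lambda>j. r * x j) = (\<lambda>j. \<Sum>i<n. (r * c i) * b i j)"
    unfolding x by (simp add: sum_distrib_left mult.assoc)
  moreover have "\<forall>i<n. r * c i \<in> polys K V \<and> b i \<in> B" using x(2) assms(2) by blast
  ultimately show ?thesis unfolding module_span_def
    by (intro CollectI exI[of _ n] exI[of _ "\<lambda>i. r * c i"] exI[of _ b] conjI)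
qed

lemma module_span_base: "x \<in> B \<Longrightarrow> x \<in> module_span K V B"
  unfolding module_span_def
  by (intro CollectI exI[of _ "1::nat"] exI[of _ "\<lambda>_. 1"] exI[of _ "\<lambda>_. x"]) auto

lemma module_span_sum:
  assumes "\<And>i. i \<in> S \<Longrightarrow> x i \<in> module_span K V B"
  shows "(\<lambda>j. \<Sum>i\<in>S. x i j) \<in> module_span K V B"
  using assms
proof (induction S rule: infinite_finite_induct)
  case (insert i F)
  then show ?case using module_span_add[of "x i" K V B "\<lambda>j. \<Sum>i\<in>F. x i j"] by simp
qed (auto intro: module_span_0)

lemma sum_single_same: "(\<Sum>i\<in>S. single k (f i)) = single k (\<Sum>i\<in>S. f i)"
  by (induction S rule: infinite_finite_induct) (simp_all add: single_add)

text \<open>The relation between two generators, scaled to monomial degree \<open>m\<close>. It is a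
  genuine syzygy only when both cover monomials divide \<open>m\<close>, and it is zero for
  \<open>C = D\<close>.\<close>

definition pair_syz :: "('v \<Rightarrow>\<^sub>0 nat) \<Rightarrow> 'v set \<Rightarrow> 'v set \<Rightarrow> 'v set \<Rightarrow> ('v, 'k::field) mpoly" where
  "pair_syz m C D = (\<lambda>j. (if j = C then single (m - ind_mon C) 1 else 0) -
     (if j = D then single (m - ind_mon D) 1 else 0))"

abbreviation cover_linear_syz :: "'k::field itself \<Rightarrow> 'v set \<Rightarrow> 'v set set \<Rightarrow> ('v set \<Rightarrow> ('v, 'k) mpoly) set" where
  "cover_linear_syz K V E \<equiv> {x \<in> syz_kernel K V {C. min_vertex_cover V E C} cover_monomial.
     \<forall>C\<in>{C. min_vertex_cover V E C}. linear_form (x C)}"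

lemma finite_min_vertex_covers: "finite V \<Longrightarrow> finite {C. min_vertex_cover V E C}"
  by (rule finite_subset[of _ "Pow V"]) (auto dest: min_vertex_coverD(2))

lemma mono_deg_single [simp]: "mono_deg (single v n) = n"
  by (simp add: mono_deg_def)

lemma linear_pair_syz:
  fixes K :: "'k::field itself" and V :: "'v set"
  assumes G: "simple_graph V E" and C: "min_vertex_cover V E C" and D: "min_vertex_cover V E D"
    and a: "C - D = {a}" and b: "D - C = {b}"
  shows "(\<lambda>j. (if j = C then var b else 0) - (if j = D then var a else 0)) \<in> cover_linear_syz K V E"
    (is "?l \<in> _")
proof -
  let ?J = "{C. min_vertex_cover V E C}"
  have finJ: "finite ?J" by (rule finite_min_vertex_covers[OF simple_graph_finite[OF G]])
  have sub: "C \<subseteq> V" "D \<subseteq> V" using min_vertex_coverD(2)[OF C] min_vertex_coverD(2)[OF D] by auto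
  have fin: "finite C" "finite D" using sub simple_graph_finite[OF G] by (auto intro: finite_subset)
  have ne: "C \<noteq> D" using a by auto
  have abV: "a \<in> V" "b \<in> V" using a b sub by auto
  have "insert b C = insert a D" "b \<notin> C" "a \<notin> D" using a b by blast+
  then have eq: "var b * cover_monomial C = (var a * cover_monomial D :: ('v, 'k) mpoly)"
    unfolding cover_monomial_def using fin by (metis prod.insert)
  have "(\<Sum>j\<in>?J. ?l j * cover_monomial j) =
      (\<Sum>j\<in>?J. if j = C then var b * cover_monomial C else 0) -
      (\<Sum>j\<in>?J. if j = D then var a * cover_monomial D else (0 :: ('v, 'k) mpoly))"
    unfolding sum_subtractf[symmetric] by (intro sum.cong) (auto simp: left_diff_distrib)
  also have "\<dots> = 0" using finJ C D eq by (simp add: sum.delta)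
  finally have "?l \<in> syz_kernel K V ?J cover_monomial"
    unfolding syz_kernel_def using abV C D by auto
  moreover have "linear_form (?l j)" for j
    using ne by (auto simp: homogeneous_of_deg_def var_def in_keys_iff lookup_single when_def split: if_splits)
  ultimately show ?thesis by blast
qed

text \<open>The degree \<open>m\<close> stays fixed: an intermediate cover lies inside
  \<open>C \<union> D\<close>, so its monomial still divides \<open>m\<close>, and the pair syzygy
  is the sum of two nearer ones.\<close>

lemma pair_syz_in_span:
  fixes K :: "'k::field itself" and V :: "'v set"
  assumes G: "simple_graph V E" and U: "unmixed V E" and thin: "thin_complete_pairs V E"
    and "min_vertex_cover V E C" "min_vertex_cover V E D" and "keys m \<subseteq> V" "C \<union> D \<subseteq> keys m"
  shows "(pair_syz m C D :: _ \<Rightarrow> ('v, 'k) mpoly) \<in> module_span K V (cover_linear_syz K V E)"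
  using assms(4-)
proof (induction "card (C - D)" arbitrary: C D rule: less_induct)
  case less
  note C = less.prems(1) and D = less.prems(2)
  have sub: "C \<subseteq> V" "D \<subseteq> V" using min_vertex_coverD(2)[OF C] min_vertex_coverD(2)[OF D] by auto
  have fin: "finite C" "finite D" using sub simple_graph_finite[OF G] by (auto intro: finite_subset)
  have eqc: "card (C - D) = card (D - C)" by (rule unmixed_card_diff[OF G U C D])
  consider "card (C - D) = 0" | "card (C - D) = 1" | "card (C - D) > 1" by linarith
  then show ?case
  proof cases
    case 1
    then have "C - D = {}" "D - C = {}"
      using eqc card_0_eq[of "C - D"] card_0_eq[of "D - C"] fin by simp_all
    then have "C = D" by blast
    then have "pair_syz m C D = (\<lambda>j. 0 :: ('v, 'k) mpoly)" by (simp add: pair_syz_def)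
    then show ?thesis by (simp only: module_span_0)
  next
    case 2
    then obtain a b where ab: "C - D = {a}" "D - C = {b}" using eqc by (metis card_1_singletonE)
    define l :: "'v set \<Rightarrow> ('v, 'k) mpoly" where "l = (\<lambda>j. (if j = C then var b else 0) - (if j = D then var a else 0))"
    \<comment> \<open>The cofactor of the least common multiple in \<open>m\<close>; it scales the
      linear exchange syzygy to degree \<open>m\<close>.\<close>
    define n where "n = m - ind_mon (C \<union> D)"
    have "keys n \<subseteq> V" using keys_minus_nat[of m "ind_mon (C \<union> D)"] less.prems(3) unfolding n_def by blast
    then have "(\<lambda>j. single n 1 * l j) \<in> module_span K V (cover_linear_syz K V E)"
      unfolding l_def by (intro module_span_scale module_span_base linear_pair_syz[OF G C D ab] polys_single)
    moreover have "single n 1 * var b = (single (m - ind_mon C) 1 :: ('v, 'k) mpoly)"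
    proof -
      have "n + single b 1 = m - ind_mon C"
      proof (rule poly_mapping_eqI)
        fix t
        have "t \<in> C \<union> D \<longleftrightarrow> t \<in> C \<or> t = b" "b \<notin> C" using ab by blast+
        moreover have "lookup m b \<noteq> 0" using less.prems(4) ab by (auto simp: in_keys_iff subset_iff)
        ultimately show "lookup (n + single b 1) t = lookup (m - ind_mon C) t"
          using fin by (auto simp: n_def lookup_add lookup_minus lookup_ind_mon lookup_single when_def)
      qed
      then show ?thesis by (simp add: var_def mult_single)
    qed
    moreover have "single n 1 * var a = (single (m - ind_mon D) 1 :: ('v, 'k) mpoly)"
    proof -
      have "n + single a 1 = m - ind_mon D"
      proof (rule poly_mapping_eqI)
        fix t
        have "t \<in> C \<union> D \<longleftrightarrow> t \<in> D \<or> t = a" "a \<notin> D" using ab by blast+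
        moreover have "lookup m a \<noteq> 0" using less.prems(4) ab by (auto simp: in_keys_iff subset_iff)
        ultimately show "lookup (n + single a 1) t = lookup (m - ind_mon D) t"
          using fin by (auto simp: n_def lookup_add lookup_minus lookup_ind_mon lookup_single when_def)
      qed
      then show ?thesis by (simp add: var_def mult_single)
    qed
    ultimately have "(\<lambda>j. single n 1 * l j) = pair_syz m C D"
      unfolding l_def pair_syz_def by (auto simp: right_diff_distrib fun_eq_iff)
    then show ?thesis using \<open>(\<lambda>j. single n 1 * l j) \<in> _\<close> by simp
  next
    case 3
    obtain a b where ab: "a \<in> C - D" "b \<in> D - C" "{a, b} \<notin> E"
      using thin_complete_pairs_nonadjacent[OF thin C D 3] .
    obtain X where X: "min_vertex_cover V E X" "X \<subseteq> C \<union> D - {a, b}"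
      using min_vertex_cover_avoiding[OF G C D ab] .
    have "card (X - D) < card (C - D)"
      using X(2) ab fin by (intro psubset_card_mono) auto
    then have 1: "(pair_syz m X D :: _ \<Rightarrow> ('v, 'k) mpoly) \<in> module_span K V (cover_linear_syz K V E)"
      by (rule less.hyps[OF _ X(1) D]) (use less.prems X in auto)
    \<comment> \<open>The set \<open>D - C\<close> loses \<open>b\<close>; unmixedness turns this
      into a bound on \<open>card (C - X)\<close>, the quantity of the induction.\<close>
    have "card (X - C) < card (D - C)"
      using X(2) ab fin by (intro psubset_card_mono) auto
    then have "card (C - X) < card (C - D)" using unmixed_card_diff[OF G U C X(1)] eqc by simp
    then have 2: "(pair_syz m C X :: _ \<Rightarrow> ('v, 'k) mpoly) \<in> module_span K V (cover_linear_syz K V E)"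
      by (rule less.hyps[OF _ C X(1)]) (use less.prems X in auto)
    have "(pair_syz m C D :: _ \<Rightarrow> ('v, 'k) mpoly) = (\<lambda>j. pair_syz m C X j + pair_syz m X D j)"
      by (simp add: pair_syz_def fun_eq_iff)
    then show ?thesis using module_span_add[OF 2 1] by simp
  qed
qed

text \<open>The fine grading: a syzygy splits into its components of monomial degree \<open>m\<close>, each of which is
  a combination of the pair syzygies of degree \<open>m\<close>.\<close>

lemma syz_in_span:
  fixes K :: "'k::field itself" and V :: "'v set"
  assumes G: "simple_graph V E" and U: "unmixed V E" and thin: "thin_complete_pairs V E"
    and x: "x \<in> syz_kernel K V {C. min_vertex_cover V E C} cover_monomial"
  shows "x \<in> module_span K V (cover_linear_syz K V E)"
proof -
  let ?J = "{C. min_vertex_cover V E C}" and ?M = "module_span K V (cover_linear_syz K V E)"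
  have finJ: "finite ?J" by (rule finite_min_vertex_covers[OF simple_graph_finite[OF G]])
  have subV: "C \<subseteq> V" if "C \<in> ?J" for C using min_vertex_coverD(2) that by blast
  have fin: "finite C" if "C \<in> ?J" for C using subV[OF that] simple_graph_finite[OF G] by (rule finite_subset)
  have xV: "x C \<in> polys K V" if "C \<in> ?J" for C using x that by (auto simp: syz_kernel_def)
  define c where "c m C = lookup (x C) (m - ind_mon C)" for m C
  define J where "J m = {C \<in> ?J. C \<subseteq> keys m}" for m :: "'v \<Rightarrow>\<^sub>0 nat"
  have finJm: "finite (J m)" for m using finJ by (simp add: J_def)
  have csum: "(\<Sum>C\<in>J m. c m C) = 0" for m
  proof -
    have "(\<Sum>C\<in>J m. c m C) = (\<Sum>C\<in>?J. lookup (x C * cover_monomial C) m)"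
      using finJ fin unfolding J_def c_def
      by (intro sum.mono_neutral_cong_left) (auto simp: lookup_mult_cover_monomial)
    also have "\<dots> = lookup (\<Sum>C\<in>?J. x C * cover_monomial C) m" by (simp add: lookup_sum)
    also have "\<dots> = 0" using x by (simp add: syz_kernel_def)
    finally show ?thesis .
  qed
  define y where "y m = (\<lambda>C. if C \<in> J m then single (m - ind_mon C) (c m C) else 0)" for m
  have yM: "y m \<in> ?M" if m: "keys m \<subseteq> V" for m
  proof (cases "J m = {}")
    case True
    then show ?thesis using module_span_0[of K V] by (simp add: y_def)
  next
    case False
    then obtain D where D: "D \<in> J m" by blast
    \<comment> \<open>Every generator is compared with one fixed \<open>D\<close>. The contributions
      at \<open>D\<close> cancel because the scalars of a homogeneous component sum to zero.\<close>
    have "(\<lambda>j. \<Sum>C\<in>J m. single 0 (c m C) * pair_syz m C D j) \<in> ?M"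
      using m D by (intro module_span_sum module_span_scale pair_syz_in_span[OF G U thin] polys_const)
        (auto simp: J_def)
    moreover have "(\<lambda>j. \<Sum>C\<in>J m. single 0 (c m C) * pair_syz m C D j) = y m"
    proof
      fix j
      have "(\<Sum>C\<in>J m. single 0 (c m C) * pair_syz m C D j) =
        (\<Sum>C\<in>J m. (if j = C then single (m - ind_mon C) (c m C) else 0)) -
        (\<Sum>C\<in>J m. (if j = D then single (m - ind_mon D) (c m C) else 0))"
        unfolding sum_subtractf[symmetric]
        by (intro sum.cong) (auto simp: pair_syz_def right_diff_distrib mult_single)
      also have "(\<Sum>C\<in>J m. (if j = D then single (m - ind_mon D) (c m C) else 0)) = 0"
      proof (cases "j = D")
        case True
        then show ?thesis using csum by (simp add: sum_single_same)
      qed simp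
      finally show "(\<Sum>C\<in>J m. single 0 (c m C) * pair_syz m C D j) = y m j"
        using finJm by (simp add: y_def)
    qed
    ultimately show ?thesis by simp
  qed
  \<comment> \<open>All monomial degrees in which \<open>x\<close> has a non-zero component.\<close>
  define S where "S = (\<Union>C\<in>?J. (\<lambda>k. ind_mon C + k) ` keys (x C))"
  have finS: "finite S" unfolding S_def using finJ by auto
  have "keys m \<subseteq> V" if "m \<in> S" for m
    using that fin subV polysD[OF xV] unfolding S_def by (fastforce simp: keys_plus_nat keys_ind_mon)
  then have "(\<lambda>C. \<Sum>m\<in>S. y m C) \<in> ?M" by (intro module_span_sum yM)
  moreover have "(\<lambda>C. \<Sum>m\<in>S. y m C) = x"
  proof
    fix C
    show "(\<Sum>m\<in>S. y m C) = x C"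
    proof (cases "C \<in> ?J")
      case False
      then have "x C = 0" using x by (auto simp: syz_kernel_def)
      then show ?thesis using False by (simp add: y_def J_def)
    next
      case True
      have "(\<Sum>m\<in>S. y m C) = (\<Sum>m\<in>(\<lambda>k. ind_mon C + k) ` keys (x C). y m C)"
      proof (rule sum.mono_neutral_right[OF finS])
        show "(\<lambda>k. ind_mon C + k) ` keys (x C) \<subseteq> S" using True by (auto simp: S_def)
        show "\<forall>m\<in>S - (\<lambda>k. ind_mon C + k) ` keys (x C). y m C = 0"
        proof
          fix m assume m: "m \<in> S - (\<lambda>k. ind_mon C + k) ` keys (x C)"
          show "y m C = 0"
          proof (cases "C \<subseteq> keys m")
            case sub: True
            have "m - ind_mon C \<notin> keys (x C)"
              using m ind_mon_plus_diff[OF fin[OF True] sub] by (metis DiffD2 imageI)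
            then show ?thesis by (simp add: y_def c_def in_keys_iff)
          qed (simp add: y_def J_def)
        qed
      qed
      also have "\<dots> = (\<Sum>k\<in>keys (x C). y (ind_mon C + k) C)"
        by (subst sum.reindex) (auto simp: inj_on_def)
      also have "\<dots> = (\<Sum>k\<in>keys (x C). single k (lookup (x C) k))"
        using True fin[OF True] by (intro sum.cong) (auto simp: y_def J_def c_def keys_plus_nat keys_ind_mon)
      also have "\<dots> = x C" by (rule poly_mapping_sum_single)
      finally show ?thesis .
    qed
  qed
  ultimately show ?thesis by simp
qed

lemma linearly_presented_if_thin:
  fixes K :: "'k::field itself" and V :: "'v set"
  assumes G: "simple_graph V E" and U: "unmixed V E" and thin: "thin_complete_pairs V E"
  shows "cover_ideal_linearly_presented K V E"
  unfolding cover_ideal_linearly_presented_def linearly_presented_def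
proof
  have "homogeneous_of_deg (card C) (cover_monomial C :: ('v, 'k) mpoly)" if "min_vertex_cover V E C" for C
  proof -
    have "finite C" using min_vertex_coverD(2)[OF that] simple_graph_finite[OF G] by (rule finite_subset)
    then show ?thesis by (simp add: homogeneous_of_deg_def cover_monomial_eq_single mono_deg_ind_mon)
  qed
  then show "\<exists>d. \<forall>C\<in>{C. min_vertex_cover V E C}. homogeneous_of_deg d (cover_monomial C :: ('v, 'k) mpoly)"
    using U unfolding unmixed_def by (metis mem_Collect_eq)
qed (use syz_in_span[OF G U thin] in blast)

lemma mono_deg_1_single:
  assumes "mono_deg v = 1"
  obtains t where "v = single t 1"
proof -
  have "v \<noteq> 0" using assms mono_deg_eq_0_iff[of v] by simp
  then obtain t where t: "t \<in> keys v" using keys_eq_empty[of v] by blast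
  have v: "v = (v - single t 1) + single t 1"
    using t by (intro poly_mapping_eqI) (auto simp: lookup_add lookup_minus lookup_single when_def in_keys_iff)
  then have "mono_deg v = mono_deg (v - single t 1) + 1" using mono_deg_add[of "v - single t 1" "single t 1"] by simp
  then have "v - single t 1 = 0" using assms mono_deg_eq_0_iff[of "v - single t 1"] by simp
  then show thesis using that v by simp
qed

text \<open>If the pair syzygy is a combination of linear ones, some linear syzygy has at
  \<open>C\<close> a term \<open>t\<close> from \<open>D - C\<close>. In degree \<open>t\<close>
  times the cover monomial of \<open>C\<close>, this term must cancel against another cover inside
  \<open>insert t C\<close>, which is a forbidden exchange.\<close>

lemma thin_if_linearly_presented:
  fixes K :: "'k::field itself" and V :: "'v set"
  assumes G: "simple_graph V E" and U: "unmixed V E" and T: "no_3_cycle E"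
    and lin: "cover_ideal_linearly_presented K V E"
  shows "thin_complete_pairs V E"
  unfolding thin_complete_pairs_def
proof (intro allI impI, elim conjE, rule ccontr)
  let ?J = "{C. min_vertex_cover V E C}"
  have finJ: "finite ?J" by (rule finite_min_vertex_covers[OF simple_graph_finite[OF G]])
  fix C D assume C: "min_vertex_cover V E C" and D: "min_vertex_cover V E D"
    and cb: "complete_between E (C - D) (D - C)" and "\<not> card (C - D) \<le> 1"
  then have big: "card (D - C) > 1" using unmixed_card_diff[OF G U C D] by simp
  then have ne: "C \<noteq> D" by auto
  have fin: "finite X" if "min_vertex_cover V E X" for X
    using min_vertex_coverD(2)[OF that] simple_graph_finite[OF G] by (rule finite_subset)
  have sub: "C \<subseteq> V" "D \<subseteq> V" using min_vertex_coverD(2) C D by blast+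
  define x :: "'v set \<Rightarrow> ('v, 'k) mpoly" where "x = pair_syz (ind_mon (C \<union> D)) C D"
  have keysCD: "keys (ind_mon (C \<union> D)) = C \<union> D" using fin C D by (simp add: keys_ind_mon)
  have "(\<Sum>j\<in>?J. x j * cover_monomial j) =
      (\<Sum>j\<in>?J. if j = C then single (ind_mon (C \<union> D) - ind_mon C) 1 * cover_monomial C else 0) -
      (\<Sum>j\<in>?J. if j = D then single (ind_mon (C \<union> D) - ind_mon D) 1 * cover_monomial D else (0 :: ('v, 'k) mpoly))"
    unfolding sum_subtractf[symmetric] x_def pair_syz_def by (intro sum.cong) auto
  also have "\<dots> = single (ind_mon (C \<union> D) - ind_mon C) 1 * cover_monomial C -
      single (ind_mon (C \<union> D) - ind_mon D) 1 * cover_monomial D"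
    using finJ C D by (simp add: sum.delta)
  also have "\<dots> = 0"
    using fin C D ind_mon_plus_diff[of C "ind_mon (C \<union> D)"] ind_mon_plus_diff[of D "ind_mon (C \<union> D)"] keysCD
    by (simp add: cover_monomial_eq_single mult_single add.commute)
  finally have "(\<Sum>j\<in>?J. x j * cover_monomial j) = 0" .
  moreover have "keys (ind_mon (C \<union> D) - k) \<subseteq> V" for k
    using keys_minus_nat[of "ind_mon (C \<union> D)" k] keysCD sub by blast
  then have "x j \<in> polys K V" for j
    unfolding x_def pair_syz_def by (intro polys_diff) (simp_all add: polys_single)
  moreover have "x j = 0" if "j \<notin> ?J" for j using that C D by (auto simp: x_def pair_syz_def)
  ultimately have "x \<in> syz_kernel K V ?J cover_monomial" by (simp add: syz_kernel_def)
  then have "x \<in> module_span K V (cover_linear_syz K V E)"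
    using lin unfolding cover_ideal_linearly_presented_def linearly_presented_def by blast
  then obtain n :: nat and c b where xb: "x = (\<lambda>j. \<Sum>i<n. c i * b i j)"
    and b: "\<And>i. i < n \<Longrightarrow> b i \<in> cover_linear_syz K V E"
    by (rule module_spanE) blast
  \<comment> \<open>The monomial of \<open>x\<close> at \<open>C\<close>: the product of the
    variables in \<open>D - C\<close>.\<close>
  define k where "k = ind_mon (C \<union> D) - ind_mon C"
  have keysk: "keys k \<subseteq> D - C"
    using fin C D by (auto simp: k_def in_keys_iff lookup_minus lookup_ind_mon split: if_splits)
  have "lookup (x C) k \<noteq> 0" using ne by (simp add: x_def pair_syz_def k_def)
  then have "(\<Sum>i<n. lookup (c i * b i C) k) \<noteq> 0" unfolding xb by (simp add: lookup_sum)
  then obtain i where i: "i < n" "lookup (c i * b i C) k \<noteq> 0"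
    by (metis (no_types, lifting) lessThan_iff sum.neutral)
  then have "k \<in> keys (c i * b i C)" by (simp add: in_keys_iff)
  then obtain u v where uv: "k = u + v" "v \<in> keys (b i C)" by (rule keys_mult_obtain)
  have "mono_deg v = 1" using b[OF i(1)] C uv(2) by (auto simp: homogeneous_of_deg_def)
  then obtain t where t: "v = single t 1" by (rule mono_deg_1_single)
  have tD: "t \<in> D - C" using keysk uv(1) t by (auto simp: keys_plus_nat)
  define m where "m = single t 1 + ind_mon C"
  have keysm: "keys m = insert t C" using fin[OF C] by (simp add: m_def keys_plus_nat keys_ind_mon)
  \<comment> \<open>Equal cardinality forces such an \<open>X\<close> to omit exactly one vertex
    \<open>s\<close> of \<open>C\<close> and to contain \<open>t\<close>.\<close>
  have only: "X = C" if X: "min_vertex_cover V E X" "X \<subseteq> insert t C" for X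
  proof (rule ccontr)
    assume nX: "X \<noteq> C"
    have cX: "card X = card C" using U X(1) C unfolding unmixed_def by blast
    have "\<not> C \<subseteq> X" using card_subset_eq[OF fin[OF X(1)]] cX nX by metis
    then obtain s where s: "s \<in> C" "s \<notin> X" by blast
    have "X \<subseteq> insert t C - {s}" using X(2) s by blast
    moreover have "card (insert t C - {s}) = card X" using cX tD s fin[OF C] by simp
    ultimately have "X = insert t C - {s}" using fin[OF C] by (intro card_subset_eq) auto
    then show False using no_exchange_of_complete_between[OF G T C D cb big tD s(1)] X(1) by simp
  qed
  have "0 = lookup (\<Sum>X\<in>?J. b i X * cover_monomial X) m"
    using b[OF i(1)] by (simp add: syz_kernel_def)
  also have "\<dots> = (\<Sum>X\<in>?J. lookup (b i X * cover_monomial X) m)" by (simp add: lookup_sum)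
  also have "\<dots> = (\<Sum>X\<in>{C}. lookup (b i X * cover_monomial X) m)"
  proof (rule sum.mono_neutral_right[OF finJ])
    show "\<forall>X\<in>?J - {C}. lookup (b i X * cover_monomial X) m = 0"
      using only keysm fin by (auto simp: lookup_mult_cover_monomial)
  qed (use C in auto)
  also have "\<dots> = lookup (b i C) (m - ind_mon C)"
    using keysm fin[OF C] by (auto simp: lookup_mult_cover_monomial)
  also have "m - ind_mon C = v" by (simp add: m_def t)
  finally show False using uv(2) by (simp add: in_keys_iff)
qed

section \<open>Symmetric differences of minimal vertex covers\<close>

context
  fixes V :: "'v set" and E :: "'v set set" and C D :: "'v set"
  assumes G: "simple_graph V E" and U: "unmixed V E"
    and C: "min_vertex_cover V E C" and D: "min_vertex_cover V E D"
begin

lemma diff_edge: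
  assumes "{x, y} \<in> induced_edges E (sym_diff C D)"
  shows "x \<in> C - D \<and> y \<in> D - C \<or> x \<in> D - C \<and> y \<in> C - D"
  using assms min_vertex_coverD(3)[OF C, of x y] min_vertex_coverD(3)[OF D, of x y]
  by (auto simp: induced_edges_def)

lemma diff_graph: "simple_graph (sym_diff C D) (induced_edges E (sym_diff C D))"
  using G min_vertex_coverD(2)[OF C] min_vertex_coverD(2)[OF D]
  by (auto simp: simple_graph_def induced_edges_def intro: finite_subset)

lemma diff_min_vertex_covers:
  "min_vertex_cover (sym_diff C D) (induced_edges E (sym_diff C D)) (C - D)"
  "min_vertex_cover (sym_diff C D) (induced_edges E (sym_diff C D)) (D - C)"
proof -
  let ?E = "induced_edges E (sym_diff C D)"
  have nb: "\<exists>y. {x, y} \<in> induced_edges E (sym_diff X Y) \<and> y \<notin> X - Y"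
    if X: "min_vertex_cover V E X" and Y: "min_vertex_cover V E Y" and x: "x \<in> X - Y" for X Y x
  proof -
    obtain y where y: "{x, y} \<in> E" "y \<notin> X" using min_vertex_cover_neighbour[OF G X] x by blast
    then have "y \<in> Y" using min_vertex_coverD(3)[OF Y y(1)] x by blast
    then show ?thesis using y x by (auto simp: induced_edges_def)
  qed
  have "is_vertex_cover (sym_diff C D) ?E (C - D)" "is_vertex_cover (sym_diff C D) ?E (D - C)"
    by (rule vertex_coverI[OF diff_graph]; use diff_edge in blast)+
  then show "min_vertex_cover (sym_diff C D) ?E (C - D)"
    "min_vertex_cover (sym_diff C D) ?E (D - C)"
    using nb[OF C D] nb[OF D C] by (auto intro!: min_vertex_coverI simp: Un_commute)
qed

text \<open>An edge missing both \<open>X\<close> and \<open>C \<inter> D\<close> would lie inside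
  the symmetric difference, where \<open>X\<close> covers. By unmixedness of both graphs the union
  has the size of \<open>C\<close>, and a cover of that size is minimal.\<close>

lemma diff_cover_extends:
  assumes U': "unmixed (sym_diff C D) (induced_edges E (sym_diff C D))"
    and X: "min_vertex_cover (sym_diff C D) (induced_edges E (sym_diff C D)) X"
  shows "min_vertex_cover V E (X \<union> (C \<inter> D))"
proof (rule unmixed_cover_card_eq_min[OF G U C])
  have XV: "X \<subseteq> sym_diff C D" using min_vertex_coverD(2)[OF X] .
  have fin: "finite C" "finite D"
    using min_vertex_coverD(2)[OF C] min_vertex_coverD(2)[OF D] simple_graph_finite[OF G]
    by (auto intro: finite_subset)
  show "is_vertex_cover V E (X \<union> (C \<inter> D))"
  proof (rule vertex_coverI[OF G])
    show "X \<union> (C \<inter> D) \<subseteq> V" using XV min_vertex_coverD(2)[OF C] min_vertex_coverD(2)[OF D] by blast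
    fix x y assume xy: "{x, y} \<in> E" "x \<notin> X \<union> (C \<inter> D)"
    show "y \<in> X \<union> (C \<inter> D)"
    proof (rule ccontr)
      assume y: "y \<notin> X \<union> (C \<inter> D)"
      have yx: "{y, x} \<in> E" using xy(1) by (simp add: insert_commute)
      have "x \<in> sym_diff C D" "y \<in> sym_diff C D"
        using min_vertex_coverD(3)[OF C xy(1)] min_vertex_coverD(3)[OF D xy(1)]
          min_vertex_coverD(3)[OF C yx] min_vertex_coverD(3)[OF D yx] xy(2) y by blast+
      then have "{x, y} \<in> induced_edges E (sym_diff C D)" using xy(1) by (simp add: induced_edges_def)
      then show False using min_vertex_coverD(3)[OF X] xy(2) y by blast
    qed
  qed
  have "card X = card (C - D)"
    using U' X diff_min_vertex_covers(1) unfolding unmixed_def by blast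
  moreover have "card (X \<union> (C \<inter> D)) = card X + card (C \<inter> D)"
    using XV fin by (intro card_Un_disjoint) (auto intro: finite_subset)
  moreover have "card C = card (C \<inter> D) + card (C - D)" using card_Int_Diff fin by blast
  ultimately show "card (X \<union> (C \<inter> D)) = card C" by simp
qed

lemma diff_thin:
  assumes thin: "thin_complete_pairs V E"
    and U': "unmixed (sym_diff C D) (induced_edges E (sym_diff C D))"
  shows "thin_complete_pairs (sym_diff C D) (induced_edges E (sym_diff C D))"
  unfolding thin_complete_pairs_def
proof (intro allI impI, elim conjE)
  fix X Y
  assume X: "min_vertex_cover (sym_diff C D) (induced_edges E (sym_diff C D)) X"
    and Y: "min_vertex_cover (sym_diff C D) (induced_edges E (sym_diff C D)) Y"
    and cb: "complete_between (induced_edges E (sym_diff C D)) (X - Y) (Y - X)"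
  have eq: "X \<union> (C \<inter> D) - (Y \<union> (C \<inter> D)) = X - Y" "Y \<union> (C \<inter> D) - (X \<union> (C \<inter> D)) = Y - X"
    using min_vertex_coverD(2)[OF X] min_vertex_coverD(2)[OF Y] by blast+
  have "complete_between E (X - Y) (Y - X)"
    using cb by (auto simp: complete_between_def induced_edges_def)
  then show "card (X - Y) \<le> 1"
    using thin diff_cover_extends[OF U' X] diff_cover_extends[OF U' Y]
    unfolding thin_complete_pairs_def eq[symmetric] by blast
qed

lemma diff_cohen_macaulay:
  assumes thin: "thin_complete_pairs V E"
    and U': "unmixed (sym_diff C D) (induced_edges E (sym_diff C D))"
  shows "cohen_macaulay_graph K (sym_diff C D) (induced_edges E (sym_diff C D))"
proof -
  define A where "A = C - D"
  define B where "B = D - C"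
  define E' where "E' = induced_edges E (A \<union> B)"
  have graph: "simple_graph (A \<union> B) E'" using diff_graph by (simp add: A_def B_def E'_def)
  have disj: "A \<inter> B = {}" by (auto simp: A_def B_def)
  have edges: "x \<in> A \<and> y \<in> B \<or> x \<in> B \<and> y \<in> A" if "{x, y} \<in> E'" for x y
    using diff_edge[of x y] that by (simp add: A_def B_def E'_def)
  have mA: "min_vertex_cover (A \<union> B) E' A" and mB: "min_vertex_cover (A \<union> B) E' B"
    using diff_min_vertex_covers by (simp_all add: A_def B_def E'_def)
  have um: "unmixed (A \<union> B) E'" using U' by (simp add: A_def B_def E'_def)
  have th: "thin_complete_pairs (A \<union> B) E'" using diff_thin[OF thin U'] by (simp add: A_def B_def E'_def)
  have AB: "A - B = A" "B - A = B" using disj by blast+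
  \<comment> \<open>The two sides are disjoint minimal covers and trivially nested, so the matching
    obtained is perfect.\<close>
  have "\<exists>\<mu>. bij_betw \<mu> (A - B) (B - A) \<and> (\<forall>a\<in>A - B. {a, \<mu> a} \<in> E') \<and>
    (\<forall>a\<in>A - B. \<forall>a'\<in>A - B. {a, \<mu> a'} \<in> E' \<and> {a', \<mu> a} \<in> E' \<longrightarrow> a = a')"
    by (rule bipartite_matching[OF graph disj _ _ um th mA mB]) (use edges disj in blast)+
  then obtain \<mu> where \<mu>: "bij_betw \<mu> A B" "\<forall>a\<in>A. {a, \<mu> a} \<in> E'"
    "\<forall>a\<in>A. \<forall>a'\<in>A. {a, \<mu> a'} \<in> E' \<and> {a', \<mu> a} \<in> E' \<longrightarrow> a = a'"
    unfolding AB by blast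
  interpret poset_bipartite A B E' \<mu>
  proof
    show "{a, \<mu> c} \<in> E'" if "a \<in> A" "b \<in> A" "c \<in> A" "{a, \<mu> b} \<in> E'" "{b, \<mu> c} \<in> E'" for a b c
      using unmixed_matching_transitive[OF graph disj um mA \<mu>(1) _ that] \<mu>(2) by blast
  qed (use graph disj edges \<mu> in auto)
  have "cohen_macaulay_graph K (A \<union> B) E'"
    by (rule cohen_macaulay) (rule unmixed_card_le_cover[OF graph um mA])
  then show ?thesis by (simp add: A_def B_def E'_def)
qed

lemma diff_complete:
  assumes cb: "complete_between E (C - D) (D - C)" and big: "card (C - D) > 1"
  shows "unmixed (sym_diff C D) (induced_edges E (sym_diff C D))"
    and "\<not> cohen_macaulay_graph K (sym_diff C D) (induced_edges E (sym_diff C D))"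
proof -
  let ?V = "sym_diff C D" and ?E = "induced_edges E (sym_diff C D)"
  have edges: "{x, y} \<in> ?E \<longleftrightarrow> x \<in> C - D \<and> y \<in> D - C \<or> x \<in> D - C \<and> y \<in> C - D" for x y
  proof
    assume xy: "x \<in> C - D \<and> y \<in> D - C \<or> x \<in> D - C \<and> y \<in> C - D"
    then have "{x, y} \<in> E \<or> {y, x} \<in> E" using cb by (auto simp: complete_between_def)
    then show "{x, y} \<in> ?E" using xy by (auto simp: induced_edges_def insert_commute)
  qed (rule diff_edge)
  have card: "card (C - D) = card (D - C)" by (rule unmixed_card_diff[OF G U C D])
  have "X = C - D \<or> X = D - C" if X: "min_vertex_cover ?V ?E X" for X
  proof -
    \<comment> \<open>A cover missing a vertex on each side would miss the edge between them, so the
      two sides are the only minimal covers.\<close>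
    have "C - D \<subseteq> X \<or> D - C \<subseteq> X"
      using min_vertex_coverD(3)[OF X] edges by blast
    then show ?thesis
      using X diff_min_vertex_covers[THEN min_vertex_coverD(1)] unfolding min_vertex_cover_def by blast
  qed
  then show "unmixed ?V ?E" unfolding unmixed_def using card by metis
  have "card (D - C) > 1" using big card by simp
  then obtain b1 b2 where "b1 \<in> D - C" "b2 \<in> D - C" "b1 \<noteq> b2"
    by (metis One_nat_def card_le_Suc0_iff_eq card.infinite less_irrefl not_less not_one_less_zero)
  moreover have "C - D \<noteq> {}" using big by force
  ultimately show "\<not> cohen_macaulay_graph K ?V ?E"
    by (intro complete_bipartite_not_cohen_macaulay[OF diff_graph _ edges]) auto
qed

end

theorem theorem5p17:
  fixes V :: "'v set" and E :: "'v set set"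
  assumes "simple_graph V E"
    and "unmixed V E"
    and "no_3_cycle E"
    and "no_5_cycle E"
  shows "cover_ideal_linearly_presented TYPE('k::field) V E \<longleftrightarrow>
    (\<forall>C1 C2. min_vertex_cover V E C1 \<and> min_vertex_cover V E C2 \<and> C1 \<noteq> C2 \<and>
       unmixed (C1 \<union> C2 - C1 \<inter> C2) (induced_edges E (C1 \<union> C2 - C1 \<inter> C2)) \<longrightarrow>
       cohen_macaulay_graph TYPE('k) (C1 \<union> C2 - C1 \<inter> C2) (induced_edges E (C1 \<union> C2 - C1 \<inter> C2)))"
    (is "?lin \<longleftrightarrow> ?cm")
proof -
  note G = assms(1) and U = assms(2)
  have sd: "C1 \<union> C2 - C1 \<inter> C2 = sym_diff C1 C2" for C1 C2 :: "'v set" by blast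
  have "?cm" if "thin_complete_pairs V E"
    unfolding sd using diff_cohen_macaulay[OF G U _ _ that] by blast
  moreover have "thin_complete_pairs V E" if cm: ?cm
    unfolding thin_complete_pairs_def
  proof (intro allI impI, elim conjE, rule ccontr)
    fix C D assume CD: "min_vertex_cover V E C" "min_vertex_cover V E D"
      "complete_between E (C - D) (D - C)" "\<not> card (C - D) \<le> 1"
    then have "C \<noteq> D" by auto
    moreover have "card (C - D) > 1" using CD(4) by simp
    ultimately show False
      using diff_complete[OF G U CD(1-3)] CD(1,2) cm unfolding sd by blast
  qed
  ultimately show ?thesis
    using linearly_presented_if_thin[OF G U] thin_if_linearly_presented[OF G U assms(3)] by blast
qed

end
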